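(* For any fixed $\varepsilon>0$, $$\left(\tfrac12+\varepsilon-\tfrac{16}3\varepsilon^3\right)n\;\lesssim\; f_{\mathrm{cut}}(n,(1/2+\varepsilon)n)\;\lesssim\;\left(\tfrac12+\varepsilon-\Omega\!\left(\frac{\varepsilon^3}{\ln(1/\varepsilon)}\right)\right)n.$$
   Context: $G(n,m)$ denotes a uniformly random graph on $n$ vertices with $m$ edges; $\max\operatorname{cut}(G)$ is the maximum over bipartitions of the vertex set of the number of edges crossing it, and $f_{\mathrm{cut}}(n,m)=\mathbb{E}[\max\operatorname{cut}(G(n,m))]$; $(1/2+\varepsilon)n$ means $\lfloor(1/2+\varepsilon)n\rfloor$. Notation: $a(n)\lesssim b(n)$ means $\limsup_{n\to\infty}a(n)/b(n)\le1$; the limit in $n$ is taken first for fixed $\varepsilon$, and the $\Omega$ refers to $\varepsilon$ small. *)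

theory Defs
  imports "HOL-Probability.Probability" "HOL-Library.Landau_Symbols"
begin

text \<open>A simple graph on the vertex set \<open>{..<n}\<close> is given by its set of edges,
  each edge being a two-element set of vertices.\<close>

definition all_edges :: "nat \<Rightarrow> nat set set" where
  "all_edges n = {e. e \<subseteq> {..<n} \<and> card e = 2}"

definition graphs :: "nat \<Rightarrow> nat \<Rightarrow> nat set set set" where
  "graphs n m = {E. E \<subseteq> all_edges n \<and> card E = m}"

text \<open>\<open>graphs n m\<close> is finite, and it is nonempty iff \<open>m \<le> n choose 2\<close>. Only in
  that case is the following distribution meaningful; for \<open>m = \<lfloor>c n\<rfloor>\<close> with \<open>c\<close> fixed
  this excludes only finitely many \<open>n\<close>.\<close>

definition random_graph :: "nat \<Rightarrow> nat \<Rightarrow> nat set set pmf" where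
  "random_graph n m = pmf_of_set (graphs n m)"

definition cut_edges :: "nat set \<Rightarrow> nat set \<Rightarrow> nat set set \<Rightarrow> nat set set" where
  "cut_edges A B E = {e \<in> E. \<exists>u\<in>A. \<exists>v\<in>B. e = {u, v}}"

definition max_cut :: "nat \<Rightarrow> nat set set \<Rightarrow> nat" where
  "max_cut n E = Max ((\<lambda>A. card (cut_edges A ({..<n} - A) E)) ` Pow {..<n})"

definition f_cut :: "nat \<Rightarrow> nat \<Rightarrow> real" where
  "f_cut n m = measure_pmf.expectation (random_graph n m) (\<lambda>E. real (max_cut n E))"

text \<open>The limit superior is taken in the extended reals. The relation is only a
  sensible comparison when \<open>b\<close> is eventually positive.\<close>

definition asymp_le :: "(nat \<Rightarrow> real) \<Rightarrow> (nat \<Rightarrow> real) \<Rightarrow> bool" where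
  "asymp_le a b \<longleftrightarrow> limsup (\<lambda>n. ereal (a n / b n)) \<le> 1"

end

theory Submission
  imports Defs
begin

text \<open>Both bounds are read off the number \<open>\<kappa>\<close> of components. A spanning forest is cut completely,
  so \<open>max_cut \<ge> n - \<kappa>\<close>. Conversely every graph has at least \<open>2\<^sup>\<kappa>\<close> maximum cuts, so the mean of
  \<open>2\<^sup>\<kappa> \<mu>\<^bsup>m - max_cut\<^esup>\<close> is at most the sum over all \<open>2\<^sup>n\<close> cuts of the mean of \<open>\<mu>\<^bsup>m - cut\<^esup>\<close>, which is about
  \<open>2\<^bsup>n - m\<^esup> (1 + \<mu>)\<^sup>m\<close>; by Jensen the mean of \<open>(m - max_cut) ln (1 / \<mu>)\<close> is at least
  \<open>ln 2\<close> times the mean cyclomatic number \<open>m - n + \<kappa>\<close>, up to \<open>\<mu> m\<close>, and \<open>\<mu>\<close> of order \<open>\<epsilon>\<^sup>3\<close> is chosen.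

  The mean of \<open>\<kappa>\<close> at average degree \<open>c > 1\<close> is compared with that at the dual degree \<open>d < 1\<close>,
  \<open>d e\<^bsup>- d\<^esup> = c e\<^bsup>- c\<^esup>\<close>: small tree components are in the fixed ratio \<open>d : c\<close>, and below the
  threshold cycles are so rare that \<open>\<kappa>\<close> is \<open>n - m\<close> up to a constant.\<close>

text \<open>A plain first moment over cuts fails: for \<epsilon> < 1/2 the factor
  \<open>2^(n - m)\<close> is exponentially large, because flipping components repeats every optimal
  cut \<open>2^\<kappa>\<close> times. The weight \<open>2^\<kappa>\<close> accounts for exactly
  this multiplicity and turns \<open>n - m\<close> into the cyclomatic number, of order
  \<open>\<epsilon>^3 n\<close>. That gain beats the loss \<open>\<mu> m\<close> once \<mu> is a
  small multiple of \<epsilon>^3; the final division by \<open>ln (1 / \<mu>)\<close> is the source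
  of the logarithm.

  The comparison of tree components is made only up to a fixed size \<open>K\<close>: at most
  \<open>n / K\<close> components are larger, so a giant component costs almost nothing when
  components, not vertices, are counted.

  Constants: with \<open>c = 1 + 2 \<epsilon>\<close> and the positive root \<rho> of
  \<open>1 - \<rho> = exp (- c \<rho>)\<close>, the dual degree is
  \<open>d = c (1 - \<rho>)\<close>, and \<open>\<kappa> / n\<close> tends to
  \<open>(d / c) (1 - d / 2) = 1/2 - \<epsilon> + excess \<rho>\<close>. Here
  \<open>excess \<rho> \<le> 2/3 (c - 1)^3 = 16/3 \<epsilon>^3\<close>, and for \<epsilon> \<le> 1/2
  also \<open>excess \<rho> \<ge> \<epsilon>^3 / 12\<close>.\<close>

section \<open>Connectivity and components\<close>

definition edges_on :: "'a set \<Rightarrow> 'a set set" where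
  "edges_on V = {e. e \<subseteq> V \<and> card e = 2}"

text \<open>Reflexive on the whole type, since the closure knows no vertex set; \<open>comps\<close>
  therefore restricts it to \<open>V \<times> V\<close> before taking the quotient.\<close>

definition conn :: "'a set set \<Rightarrow> ('a \<times> 'a) set" where
  "conn E = {(u, v). {u, v} \<in> E}\<^sup>*"

definition comps :: "'a set \<Rightarrow> 'a set set \<Rightarrow> 'a set set" where
  "comps V E = V // (conn E \<inter> V \<times> V)"

lemma all_edges_eq: "all_edges n = edges_on {..<n}"
  by (simp add: all_edges_def edges_on_def)

lemma edges_on_mono: "S \<subseteq> V \<Longrightarrow> edges_on S \<subseteq> edges_on V"
  by (auto simp: edges_on_def)

lemma edges_onE:
  assumes "e \<in> edges_on V"
  obtains u v where "e = {u, v}" "u \<noteq> v" "u \<in> V" "v \<in> V"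
  using assms by (auto simp: edges_on_def card_2_iff)

lemma pair_in_edges_on [simp]: "{u, v} \<in> edges_on V \<longleftrightarrow> u \<in> V \<and> v \<in> V \<and> u \<noteq> v"
  by (auto simp: edges_on_def card_2_iff doubleton_eq_iff)

lemma finite_edges_on [simp, intro]: "finite V \<Longrightarrow> finite (edges_on V)"
  by (rule finite_subset[of _ "Pow V"]) (auto simp: edges_on_def)

lemma card_edges_on: "finite V \<Longrightarrow> card (edges_on V) = card V choose 2"
  by (simp add: edges_on_def n_subsets)

lemma conn_refl [simp]: "(u, u) \<in> conn E"
  by (simp add: conn_def)

lemma conn_trans: "(u, v) \<in> conn E \<Longrightarrow> (v, w) \<in> conn E \<Longrightarrow> (u, w) \<in> conn E"
  unfolding conn_def by (rule rtrancl_trans)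

lemma conn_sym: "(u, v) \<in> conn E \<Longrightarrow> (v, u) \<in> conn E"
proof -
  have "sym {(u, v). {u, v} \<in> E}"
    by (auto simp: sym_def insert_commute)
  then show "(u, v) \<in> conn E \<Longrightarrow> (v, u) \<in> conn E"
    unfolding conn_def by (meson sym_rtrancl symD)
qed

lemma conn_edge: "{u, v} \<in> E \<Longrightarrow> (u, v) \<in> conn E"
  by (auto simp: conn_def)

lemma conn_mono: "E \<subseteq> E' \<Longrightarrow> conn E \<subseteq> conn E'"
  unfolding conn_def by (rule rtrancl_mono) auto

lemma conn_insert:
  "(x, y) \<in> conn (insert {u, v} E) \<longleftrightarrow>
     (x, y) \<in> conn E \<or> (x, u) \<in> conn E \<and> (v, y) \<in> conn E \<or> (x, v) \<in> conn E \<and> (u, y) \<in> conn E"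
    (is "?L \<longleftrightarrow> ?R")
proof -
  have "{(a, b). {a, b} \<in> insert {u, v} E} = insert (u, v) (insert (v, u) {(a, b). {a, b} \<in> E})"
    by (auto simp: doubleton_eq_iff)
  then have *: "conn (insert {u, v} E) = (insert (u, v) (insert (v, u) {(a, b). {a, b} \<in> E}))\<^sup>*"
    by (simp add: conn_def)
  show ?thesis
    \<comment> \<open>Adding the two arcs one after the other also produces walks through both;
      transitivity collapses these to one of the three cases.\<close>
    unfolding * rtrancl_insert conn_def[symmetric] Un_iff mem_Collect_eq prod.case
    using conn_refl[of u E] conn_refl[of v E] conn_trans[of x u E y] conn_trans[of x v E y] by blast
qed

lemma conn_insert_joined:
  assumes "(u, v) \<in> conn E"
  shows "conn (insert {u, v} E) = conn E"
  using assms conn_sym[OF assms] unfolding set_eq_iff split_paired_All conn_insert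
  by (meson conn_trans)

lemma equiv_conn: "equiv V (conn E \<inter> V \<times> V)"
proof (rule equivI)
  show "sym (conn E \<inter> V \<times> V)"
    by (rule symI) (auto dest: conn_sym)
  show "trans (conn E \<inter> V \<times> V)"
    by (rule transI) (blast dest: conn_trans)
qed (auto intro: refl_onI)

lemma finite_comps: "finite V \<Longrightarrow> finite (comps V E)"
  unfolding comps_def by (rule finite_quotient) auto

lemma comps_partition:
  shows "\<Union>(comps V E) = V"
    and "{} \<notin> comps V E"
    and "\<lbrakk>C \<in> comps V E; D \<in> comps V E; C \<noteq> D\<rbrakk> \<Longrightarrow> C \<inter> D = {}"
  unfolding comps_def
  using Union_quotient[OF equiv_conn, of V E] in_quotient_imp_non_empty[OF equiv_conn, of "{}" V E]
    quotient_disj[OF equiv_conn, of C V E D] by auto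

lemma comps_iff:
  "C \<in> comps V E \<longleftrightarrow> (\<exists>x\<in>V. C = {y\<in>V. (x, y) \<in> conn E})"
  by (auto simp: comps_def quotient_def)

lemma comps_eq_image: "comps V E = (\<lambda>x. {y\<in>V. (x, y) \<in> conn E}) ` V"
  by (auto simp: comps_iff)

lemma comps_closed:
  assumes "C \<in> comps V E" "x \<in> C" "(x, y) \<in> conn E" "y \<in> V"
  shows "y \<in> C"
  using assms conn_trans[of _ x E y] by (auto simp: comps_iff)

lemma comps_connected:
  assumes "C \<in> comps V E" "x \<in> C" "y \<in> C"
  shows "(x, y) \<in> conn E"
  using assms conn_trans[of x _ E y] conn_sym[of _ x E] by (auto simp: comps_iff)

lemma comps_empty: "comps V {} = (\<lambda>x. {x}) ` V"
  by (auto simp: comps_iff conn_def)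

lemma card_comps_empty: "card (comps V {}) = card V"
  by (simp add: comps_empty card_image)

lemma comps_insert_joined:
  assumes "(u, v) \<in> conn E"
  shows "comps V (insert {u, v} E) = comps V E"
  by (simp add: comps_def conn_insert_joined[OF assms])

text \<open>The classes of \<open>u\<close> and \<open>v\<close> are replaced by their union and all
  others stay. The union is not among the others, since it meets the class of \<open>u\<close> and
  distinct classes are disjoint.\<close>

lemma card_comps_insert:
  assumes fin: "finite V" and uv: "u \<in> V" "v \<in> V" and nc: "(u, v) \<notin> conn E"
  shows "Suc (card (comps V (insert {u, v} E))) = card (comps V E)"
proof -
  define C where "C = (\<lambda>x. {y\<in>V. (x, y) \<in> conn E})"
  have C: "comps V E = C ` V"
    by (simp add: comps_eq_image C_def)
  have C': "{y\<in>V. (x, y) \<in> conn (insert {u, v} E)} =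
      (if x \<in> C u \<union> C v then C u \<union> C v else C x)" if "x \<in> V" for x
  proof (cases "x \<in> C u \<union> C v")
    case True
    then have "(x, y) \<in> conn (insert {u, v} E) \<longleftrightarrow> (u, y) \<in> conn E \<or> (v, y) \<in> conn E" for y
      unfolding conn_insert C_def by (blast intro: conn_trans conn_sym)
    with True show ?thesis
      by (auto simp: C_def)
  next
    case False
    then have "(x, y) \<in> conn (insert {u, v} E) \<longleftrightarrow> (x, y) \<in> conn E" for y
      using that unfolding conn_insert C_def by (blast intro: conn_sym)
    with False show ?thesis
      by (auto simp: C_def)
  qed
  have "comps V (insert {u, v} E) = (\<lambda>x. if x \<in> C u \<union> C v then C u \<union> C v else C x) ` V"
    unfolding comps_eq_image using C' by (rule image_cong[OF refl])
  also have "\<dots> = insert (C u \<union> C v) (comps V E - {C u, C v})"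
  proof -
    have 1: "x \<in> C x" if "x \<in> V" for x using that by (simp add: C_def)
    have 2: "C x = C y" if "x \<in> C y" for x y
      using that unfolding C_def by (blast intro: conn_trans conn_sym)
    have 3: "C x \<noteq> C u \<and> C x \<noteq> C v \<longleftrightarrow> x \<notin> C u \<union> C v" if "x \<in> V" for x
      using 1[OF that] 2[of x u] 2[of x v] by blast
    have 4: "u \<in> C u" using 1 uv by simp
    show ?thesis
    proof (intro equalityI subsetI)
      fix D assume "D \<in> (\<lambda>x. if x \<in> C u \<union> C v then C u \<union> C v else C x) ` V"
      then obtain x where x: "x \<in> V" "D = (if x \<in> C u \<union> C v then C u \<union> C v else C x)"
        by (rule imageE)
      show "D \<in> insert (C u \<union> C v) (comps V E - {C u, C v})"
      proof (cases "x \<in> C u \<union> C v")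
        case True
        then show ?thesis using x by simp
      next
        case False
        then have "D = C x" "C x \<noteq> C u" "C x \<noteq> C v"
          using x 3[OF x(1)] by simp_all
        then show ?thesis using x(1) by (simp add: C)
      qed
    next
      fix D assume "D \<in> insert (C u \<union> C v) (comps V E - {C u, C v})"
      then consider "D = C u \<union> C v" | x where "x \<in> V" "D = C x" "C x \<noteq> C u \<and> C x \<noteq> C v"
        unfolding C by blast
      then show "D \<in> (\<lambda>x. if x \<in> C u \<union> C v then C u \<union> C v else C x) ` V"
      proof cases
        case 1
        then show ?thesis using uv(1) 4 by (intro image_eqI[of _ _ u]) simp_all
      next
        case (2 x)
        then show ?thesis using 3[OF 2(1)] by (intro image_eqI[of _ _ x]) simp_all
      qed
    qed
  qed
  finally have eq: "comps V (insert {u, v} E) = insert (C u \<union> C v) (comps V E - {C u, C v})" .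
  have mem: "C u \<in> comps V E" "C v \<in> comps V E"
    using uv by (auto simp: C)
  have ne: "C u \<noteq> C v"
  proof -
    have "v \<in> C v" "v \<notin> C u"
      using nc uv by (simp_all add: C_def)
    then show ?thesis by blast
  qed
  have "C u \<union> C v \<notin> comps V E - {C u, C v}"
  proof
    assume a: "C u \<union> C v \<in> comps V E - {C u, C v}"
    then have "(C u \<union> C v) \<inter> C u = {}"
      using comps_partition(3)[of "C u \<union> C v" V E "C u"] mem by blast
    moreover have "u \<in> C u"
      using uv by (simp add: C_def)
    ultimately show False by blast
  qed
  moreover have "card (comps V E - {C u, C v}) = card (comps V E) - 2"
    using mem ne finite_comps[OF fin] by (subst card_Diff_subset) auto
  moreover have "card {C u, C v} \<le> card (comps V E)"
    using mem finite_comps[OF fin] by (intro card_mono) auto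
  ultimately show ?thesis
    unfolding eq using ne finite_comps[OF fin] by simp
qed

text \<open>Greedy choice: an edge is kept only if it joins two classes, and then it lowers their
  number by one. The count in the conclusion is how acyclicity of \<open>F\<close> is
  expressed.\<close>

lemma spanning_forest:
  assumes "finite V" "E \<subseteq> edges_on V"
  shows "\<exists>F\<subseteq>E. conn F = conn E \<and> card F + card (comps V E) = card V"
proof -
  have "finite E"
    using assms finite_subset by blast
  then show ?thesis using assms(2)
  proof (induction E)
    case empty
    then show ?case by (simp add: card_comps_empty)
  next
    case (insert e E)
    obtain u v where e: "e = {u, v}" and uv: "u \<in> V" "v \<in> V"
      using insert.prems by (auto elim: edges_onE)
    obtain F where F: "F \<subseteq> E" "conn F = conn E" "card F + card (comps V E) = card V"
      using insert by auto
    show ?case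
    proof (cases "(u, v) \<in> conn E")
      case True
      with F show ?thesis
        by (intro exI[of _ F]) (auto simp: e conn_insert_joined comps_insert_joined)
    next
      case False
      have "conn (insert e F) = conn (insert e E)"
        unfolding e using F(2) by (auto simp: conn_insert)
      moreover have "card (insert e F) = Suc (card F)"
        using F(1) insert.hyps finite_subset by (subst card_insert_disjoint) blast+
      moreover have "Suc (card (comps V (insert e E))) = card (comps V E)"
        unfolding e by (rule card_comps_insert) (use assms uv False in auto)
      ultimately show ?thesis
        using F by (intro exI[of _ "insert e F"]) auto
    qed
  qed
qed

lemma card_comps_ge:
  assumes "finite V" "E \<subseteq> edges_on V"
  shows "card V \<le> card (comps V E) + card E"
proof -
  obtain F where "F \<subseteq> E" "card F + card (comps V E) = card V"
    using spanning_forest[OF assms] by blast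
  moreover have "card F \<le> card E"
    using \<open>F \<subseteq> E\<close> assms finite_subset by (intro card_mono) blast+
  ultimately show ?thesis by simp
qed

lemma card_comps_le: "finite V \<Longrightarrow> card (comps V E) \<le> card V"
  unfolding comps_eq_image by (rule card_image_le)

section \<open>Cuts\<close>

lemma pair_in_cut:
  assumes "x \<in> V" "y \<in> V"
  shows "{x, y} \<in> cut_edges A (V - A) E \<longleftrightarrow> {x, y} \<in> E \<and> (x \<in> A \<longleftrightarrow> y \<notin> A)"
  using assms by (auto simp: cut_edges_def doubleton_eq_iff)

lemma cut_edges_subset: "cut_edges A B E \<subseteq> E"
  by (auto simp: cut_edges_def)

text \<open>No edge leaves \<open>U\<close>, so when the vertices of \<open>U\<close> change sides,
  an edge has both ends moved or neither. This serves both to improve a cut and to count equivalent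
  cuts.\<close>

lemma cut_edges_sym_diff:
  assumes E: "E \<subseteq> edges_on V"
    and U: "\<And>x y. {x, y} \<in> E \<Longrightarrow> x \<in> U \<Longrightarrow> y \<in> U"
  shows "cut_edges (sym_diff A U) (V - sym_diff A U) E = cut_edges A (V - A) E"
proof (rule set_eqI)
  fix e
  show "e \<in> cut_edges (sym_diff A U) (V - sym_diff A U) E \<longleftrightarrow> e \<in> cut_edges A (V - A) E"
  proof (cases "e \<in> E")
    case True
    then obtain x y where e: "e = {x, y}" and xy: "x \<in> V" "y \<in> V"
      using E by (meson edges_onE subsetD)
    have "x \<in> U \<longleftrightarrow> y \<in> U"
      using U[of x y] U[of y x] True e by (auto simp: insert_commute)
    then show ?thesis
      unfolding e pair_in_cut[OF xy] by auto
  next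
    case False
    then show ?thesis
      using cut_edges_subset by blast
  qed
qed

text \<open>Edges are added one at a time. An edge joining two components can be made to cross by
  flipping the component of one end, which disturbs no earlier edge; any other edge may be
  ignored.\<close>

lemma large_cut:
  assumes "finite V" "E \<subseteq> edges_on V"
  shows "\<exists>A\<subseteq>V. card V \<le> card (cut_edges A (V - A) E) + card (comps V E)"
proof -
  have "finite E"
    using assms finite_subset by blast
  then show ?thesis using assms(2)
  proof (induction E)
    case empty
    then show ?case by (auto simp: card_comps_empty)
  next
    case (insert e E)
    obtain u v where e: "e = {u, v}" and uv: "u \<in> V" "v \<in> V" "u \<noteq> v"
      using insert.prems by (auto elim: edges_onE)
    obtain A where A: "A \<subseteq> V" "card V \<le> card (cut_edges A (V - A) E) + card (comps V E)"
      using insert by auto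
    have mono: "card (cut_edges B (V - B) E) \<le> card (cut_edges B (V - B) (insert e E))" for B
      by (rule card_mono) (use insert.hyps in \<open>auto simp: cut_edges_def\<close>)
    show ?case
    proof (cases "(u, v) \<in> conn E")
      case True
      with A mono[of A] show ?thesis
        by (intro exI[of _ A]) (auto simp: e comps_insert_joined)
    next
      case False
      define U where "U = {y\<in>V. (u, y) \<in> conn E}"
      define B where "B = (if (u \<in> A) = (v \<notin> A) then A else sym_diff A U)"
      have "cut_edges (sym_diff A U) (V - sym_diff A U) E = cut_edges A (V - A) E"
      proof (rule cut_edges_sym_diff)
        show "E \<subseteq> edges_on V" using insert.prems by auto
        show "y \<in> U" if "{x, y} \<in> E" "x \<in> U" for x y
          using that insert.prems conn_edge[of x y E] conn_trans[of u x E y]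
          by (auto simp: U_def)
      qed
      then have cutB: "cut_edges B (V - B) E = cut_edges A (V - A) E"
        by (simp add: B_def)
      have BV: "B \<subseteq> V"
        using A(1) by (auto simp: B_def U_def)
      have "u \<in> U" "v \<notin> U"
        using uv False by (auto simp: U_def)
      then have "(u \<in> B) = (v \<notin> B)"
        by (auto simp: B_def)
      then have "e \<in> cut_edges B (V - B) (insert e E)"
        unfolding e pair_in_cut[OF uv(1,2)] by auto
      then have "insert e (cut_edges B (V - B) E) \<subseteq> cut_edges B (V - B) (insert e E)"
        by (auto simp: cut_edges_def)
      moreover have "e \<notin> cut_edges B (V - B) E"
        using insert.hyps cut_edges_subset by blast
      moreover have "finite (cut_edges B (V - B) (insert e E))"
        using insert.hyps cut_edges_subset finite_subset by (metis finite_insert)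
      ultimately have "Suc (card (cut_edges B (V - B) E)) \<le> card (cut_edges B (V - B) (insert e E))"
        by (metis card_insert_disjoint card_mono finite_insert finite_subset)
      moreover have "Suc (card (comps V (insert e E))) = card (comps V E)"
        unfolding e by (rule card_comps_insert) (use assms uv False in auto)
      ultimately show ?thesis
        using A cutB BV by (intro exI[of _ B]) auto
    qed
  qed
qed

text \<open>Complementing a cut on a union of components does not change its edges.\<close>

lemma card_equal_cuts:
  assumes fin: "finite V" and E: "E \<subseteq> edges_on V" and A: "A \<subseteq> V"
  shows "2 ^ card (comps V E) \<le>
    card {B. B \<subseteq> V \<and> cut_edges B (V - B) E = cut_edges A (V - A) E}"
proof -
  \<comment> \<open>Components are nonempty and disjoint, so a family of them is determined by its
    union, and symmetric difference with \<open>A\<close> is injective.\<close>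
  have "inj_on (\<lambda>\<U>. sym_diff A (\<Union>\<U>)) (Pow (comps V E))"
  proof (rule inj_onI)
    fix \<U> \<W>
    assume U: "\<U> \<in> Pow (comps V E)" and W: "\<W> \<in> Pow (comps V E)"
      and eq: "sym_diff A (\<Union>\<U>) = sym_diff A (\<Union>\<W>)"
    from eq have un: "\<Union>\<U> = \<Union>\<W>"
      by blast
    have *: "\<X> \<subseteq> \<Y>" if sub: "\<X> \<subseteq> comps V E" "\<Y> \<subseteq> comps V E" "\<Union>\<X> = \<Union>\<Y>" for \<X> \<Y>
    proof
      fix C assume C: "C \<in> \<X>"
      then have CV: "C \<in> comps V E"
        using sub by blast
      then obtain x where "x \<in> C"
        using comps_partition(2)[of V E] by (cases "C = {}") auto
      then obtain D where "D \<in> \<Y>" "x \<in> D"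
        using C sub(3) by blast
      then show "C \<in> \<Y>"
        using \<open>x \<in> C\<close> CV sub(2) comps_partition(3)[of C V E D] by blast
    qed
    show "\<U> = \<W>"
      using *[of \<U> \<W>] *[of \<W> \<U>] U W un by auto
  qed
  moreover have "(\<lambda>\<U>. sym_diff A (\<Union>\<U>)) ` Pow (comps V E) \<subseteq>
    {B. B \<subseteq> V \<and> cut_edges B (V - B) E = cut_edges A (V - A) E}"
  proof clarsimp
    fix \<U> assume U: "\<U> \<subseteq> comps V E"
    then have "\<Union>\<U> \<subseteq> V"
      using comps_partition(1)[of V E] by blast
    moreover have "cut_edges (sym_diff A (\<Union>\<U>)) (V - sym_diff A (\<Union>\<U>)) E = cut_edges A (V - A) E"
    proof (rule cut_edges_sym_diff[OF E])
      fix x y assume xy: "{x, y} \<in> E" "x \<in> \<Union>\<U>"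
      then obtain C where "C \<in> \<U>" "x \<in> C" by blast
      moreover have "y \<in> V"
        using xy E by auto
      moreover have "C \<in> comps V E"
        using U \<open>C \<in> \<U>\<close> by (rule subsetD)
      ultimately have "y \<in> C"
        using comps_closed conn_edge[OF xy(1)] by metis
      then show "y \<in> \<Union>\<U>"
        using \<open>C \<in> \<U>\<close> by (rule UnionI[rotated])
    qed
    ultimately show "A - \<Union>\<U> \<subseteq> V \<and> \<Union>\<U> - A \<subseteq> V \<and>
       cut_edges (sym_diff A (\<Union>\<U>)) (V - sym_diff A (\<Union>\<U>)) E = cut_edges A (V - A) E"
      using A by (simp only: simp_thms) (meson Diff_subset subset_trans)
  qed
  ultimately have "card (Pow (comps V E)) \<le>
     card {B. B \<subseteq> V \<and> cut_edges B (V - B) E = cut_edges A (V - A) E}"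
    using fin by (intro card_inj_on_le) auto
  then show ?thesis
    by (simp add: card_Pow finite_comps[OF fin])
qed

section \<open>Paths and cycles\<close>

fun path_edges :: "'a list \<Rightarrow> 'a set set" where
  "path_edges (x # y # xs) = insert {x, y} (path_edges (y # xs))"
| "path_edges _ = {}"

definition cycle_edges :: "'a list \<Rightarrow> 'a set set" where
  "cycle_edges xs = insert {last xs, hd xs} (path_edges xs)"

text \<open>A cycle is a list with a starting point and a direction, so one of length
  \<open>l\<close> appears \<open>2 l\<close> times. Only upper bounds on this number are ever
  taken, so the repetition is harmless.\<close>

definition cycles :: "'a set \<Rightarrow> 'a set set \<Rightarrow> 'a list set" where
  "cycles V E = {xs. distinct xs \<and> set xs \<subseteq> V \<and> 3 \<le> length xs \<and> cycle_edges xs \<subseteq> E}"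

lemma path_edges_subset: "e \<in> path_edges xs \<Longrightarrow> e \<subseteq> set xs"
  by (induction xs rule: path_edges.induct) auto

lemma path_edges_edges_on: "distinct xs \<Longrightarrow> path_edges xs \<subseteq> edges_on (set xs)"
proof (induction xs rule: path_edges.induct)
  case (1 x y xs)
  have "edges_on (set (y # xs)) \<subseteq> edges_on (set (x # y # xs))"
    by (rule edges_on_mono) auto
  with 1 show ?case by auto
qed auto

lemma finite_path_edges [simp]: "finite (path_edges xs)"
  by (induction xs rule: path_edges.induct) auto

lemma card_path_edges: "distinct xs \<Longrightarrow> card (path_edges xs) = length xs - 1"
proof (induction xs rule: path_edges.induct)
  case (1 x y xs)
  have "{x, y} \<notin> path_edges (y # xs)"
    using path_edges_subset[of "{x, y}" "y # xs"] 1 by auto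
  with 1 show ?case by simp
qed auto

text \<open>From length 3 on, the closing edge differs from all path edges; on two vertices it would
  repeat the single path edge.\<close>

lemma card_cycle_edges:
  assumes "distinct xs" "3 \<le> length xs"
  shows "card (cycle_edges xs) = length xs"
proof -
  obtain x y z zs where xs: "xs = x # y # z # zs"
    using assms(2) by (auto simp: numeral_3_eq_3 Suc_le_length_iff)
  have "last (z # zs) \<in> set (z # zs)"
    by (rule last_in_set) simp
  then have "last xs \<noteq> x" "last xs \<noteq> y"
    using assms(1) by (auto simp: xs)
  then have "{last xs, x} \<noteq> {x, y}"
    by (auto simp: doubleton_eq_iff)
  moreover have "{last xs, x} \<notin> path_edges (y # z # zs)"
    using path_edges_subset[of "{last xs, x}" "y # z # zs"] assms(1) by (auto simp: xs)
  ultimately have "{last xs, hd xs} \<notin> path_edges xs"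
    by (simp add: xs)
  then show ?thesis
    using card_path_edges[OF assms(1)] assms(2) by (simp add: cycle_edges_def)
qed

lemma cycle_edges_edges_on:
  assumes "distinct xs" "3 \<le> length xs"
  shows "cycle_edges xs \<subseteq> edges_on (set xs)"
proof -
  obtain x y zs where xs: "xs = x # y # zs"
    using assms(2) by (auto simp: numeral_3_eq_3 Suc_le_length_iff)
  have "last (y # zs) \<in> set (y # zs)"
    by (rule last_in_set) simp
  then have "{last xs, hd xs} \<in> edges_on (set xs)"
    using assms(1) by (auto simp: xs)
  then show ?thesis
    using path_edges_edges_on[OF assms(1)] by (simp add: cycle_edges_def)
qed

lemma finite_cycles: "finite V \<Longrightarrow> finite (cycles V E)"
  by (rule finite_subset[OF _ finite_subset_distinct]) (auto simp: cycles_def)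

lemma path_edges_dropWhile: "path_edges (dropWhile P xs) \<subseteq> path_edges xs"
proof (induction xs rule: path_edges.induct)
  case (1 x y xs)
  then show ?case by (cases "P x") auto
qed auto

text \<open>The walk is read from its far end. If the new first vertex already lies on the path
  built so far, the path is cut back to that vertex; otherwise the vertex is prepended.\<close>

lemma conn_path:
  assumes "(u, v) \<in> conn E" "E \<subseteq> edges_on V" "v \<in> V"
  shows "\<exists>xs. xs \<noteq> [] \<and> distinct xs \<and> set xs \<subseteq> V \<and> hd xs = u \<and> last xs = v \<and> path_edges xs \<subseteq> E"
  using assms(1) unfolding conn_def
proof (induction rule: converse_rtrancl_induct)
  case base
  then show ?case using assms(3) by (intro exI[of _ "[v]"]) auto
next
  case (step u w)
  then obtain xs where xs: "xs \<noteq> []" "distinct xs" "set xs \<subseteq> V" "hd xs = w" "last xs = v"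
      "path_edges xs \<subseteq> E"
    by blast
  have e: "{u, w} \<in> E"
    using step.hyps by simp
  show ?case
  proof (cases "u \<in> set xs")
    case False
    obtain ys where "xs = w # ys"
      using xs(1,4) by (cases xs) auto
    moreover have "u \<in> V"
      using e assms(2) by auto
    ultimately show ?thesis
      using xs e False by (intro exI[of _ "u # xs"]) auto
  next
    case True
    define ys where "ys = dropWhile (\<lambda>x. x \<noteq> u) xs"
    have ne: "ys \<noteq> []"
      using True by (auto simp: ys_def)
    have "hd ys = u"
      using hd_dropWhile[of "\<lambda>x. x \<noteq> u" xs] ne by (auto simp: ys_def)
    moreover have "last ys = last xs"
      using ne takeWhile_dropWhile_id[of "\<lambda>x. x \<noteq> u" xs] unfolding ys_def
      by (metis last_appendR)
    moreover have "set ys \<subseteq> V" "distinct ys" "path_edges ys \<subseteq> E"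
      using xs set_dropWhileD path_edges_dropWhile[of "\<lambda>x. x \<noteq> u" xs] unfolding ys_def
      by (auto dest: set_dropWhileD)
    ultimately show ?thesis
      using ne xs by blast
  qed
qed

text \<open>Building the graph edge by edge, each edge that does not join two components closes a new cycle.\<close>

lemma card_comps_le_cycles:
  assumes "finite V" "E \<subseteq> edges_on V"
  shows "card (comps V E) + card E \<le> card V + card (cycles V E)"
proof -
  have "finite E"
    using assms finite_subset by blast
  then show ?thesis using assms(2)
  proof (induction E)
    case empty
    then show ?case by (simp add: card_comps_empty)
  next
    case (insert e E)
    obtain u v where e: "e = {u, v}" and uv: "u \<in> V" "v \<in> V" "u \<noteq> v"
      using insert.prems by (auto elim: edges_onE)
    have EV: "E \<subseteq> edges_on V"
      using insert.prems by auto
    have IH: "card (comps V E) + card E \<le> card V + card (cycles V E)"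
      using insert.IH EV by blast
    have sub: "cycles V E \<subseteq> cycles V (insert e E)"
      by (auto simp: cycles_def)
    have fin: "finite (cycles V (insert e E))"
      using assms(1) by (rule finite_cycles)
    show ?case
    proof (cases "(u, v) \<in> conn E")
      case True
      then obtain xs where xs: "xs \<noteq> []" "distinct xs" "set xs \<subseteq> V" "hd xs = u" "last xs = v"
          "path_edges xs \<subseteq> E"
        using conn_path[OF True EV uv(2)] by blast
      \<comment> \<open>One vertex would force \<open>u = v\<close>, and two vertices would make the
        path the edge \<open>e\<close> itself, which is not yet in \<open>E\<close>.\<close>
      have "3 \<le> length xs"
      proof (rule ccontr)
        assume "\<not> 3 \<le> length xs"
        then have "length xs \<le> 2" by simp
        then consider "xs = []" | a where "xs = [a]" | a b where "xs = [a, b]"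
          by (cases xs; cases "tl xs") auto
        then show False
          using xs uv insert.hyps by cases (auto simp: e)
      qed
      then have "xs \<in> cycles V (insert e E)" "xs \<notin> cycles V E"
        using xs insert.hyps by (auto simp: cycles_def cycle_edges_def e insert_commute)
      then have "card (cycles V E) < card (cycles V (insert e E))"
        using sub fin by (intro psubset_card_mono) auto
      moreover have "card (comps V (insert e E)) = card (comps V E)"
        unfolding e comps_insert_joined[OF True] ..
      ultimately show ?thesis
        using IH insert.hyps by simp
    next
      case False
      have "Suc (card (comps V (insert e E))) = card (comps V E)"
        unfolding e by (rule card_comps_insert) (use assms uv False in auto)
      moreover have "card (cycles V E) \<le> card (cycles V (insert e E))"
        using sub fin by (rule card_mono[rotated])
      ultimately show ?thesis
        using IH insert.hyps by simp
    qed
  qed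
qed

section \<open>Tree components\<close>

text \<open>Trees are characterised by connectedness and edge count. The \<open>Suc\<close> also
  rules out the empty vertex set.\<close>

definition trees :: "'a set \<Rightarrow> 'a set set set" where
  "trees S = {T. T \<subseteq> edges_on S \<and> Suc (card T) = card S \<and> S \<times> S \<subseteq> conn T}"

definition set_trees :: "'a set \<Rightarrow> nat \<Rightarrow> ('a set \<times> 'a set set) set" where
  "set_trees V k = (SIGMA S:{S. S \<subseteq> V \<and> card S = k}. trees S)"

lemma finite_trees: "finite S \<Longrightarrow> finite (trees S)"
  by (rule finite_subset[of _ "Pow (edges_on S)"]) (auto simp: trees_def)

lemma finite_set_trees: "finite V \<Longrightarrow> finite (set_trees V k)"
  unfolding set_trees_def
  by (rule finite_SigmaI) (auto intro: finite_trees finite_subset)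

text \<open>A walk starting in a component never leaves it, so it uses only edges inside.\<close>

lemma conn_within_comp:
  assumes C: "C \<in> comps V E" and E: "E \<subseteq> edges_on V" and xy: "x \<in> C" "y \<in> C"
  shows "(x, y) \<in> conn {e\<in>E. e \<subseteq> C}"
proof -
  have "(x, y) \<in> conn E"
    using comps_connected[OF C xy] .
  then have "y \<in> C \<and> (x, y) \<in> conn {e\<in>E. e \<subseteq> C}"
    unfolding conn_def[of E]
  proof (induction rule: rtrancl_induct)
    case base
    then show ?case using xy by simp
  next
    case (step y z)
    then have e: "{y, z} \<in> E" and "z \<in> V"
      using E by auto
    then have "z \<in> C"
      using comps_closed[OF C, of y z] step.IH conn_edge[OF e] by blast
    then have "(y, z) \<in> conn {e\<in>E. e \<subseteq> C}"
      using e step.IH by (intro conn_edge) auto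
    then show ?case
      using step.IH \<open>z \<in> C\<close> conn_trans[of x y _ z] by blast
  qed
  then show ?thesis ..
qed

lemma ex_tree_comp:
  assumes fin: "finite V" and E: "E \<subseteq> edges_on V" and C: "C \<in> comps V E"
  shows "\<exists>T\<in>trees C. T \<subseteq> E"
proof -
  define E' where "E' = {e\<in>E. e \<subseteq> C}"
  have CV: "C \<subseteq> V"
    using C comps_partition(1)[of V E] by blast
  have E': "E' \<subseteq> edges_on C"
    using E by (auto simp: E'_def edges_on_def)
  have con: "(x, y) \<in> conn E'" if "x \<in> C" "y \<in> C" for x y
    unfolding E'_def using conn_within_comp[OF C E that] .
  obtain F where F: "F \<subseteq> E'" "conn F = conn E'" "card F + card (comps C E') = card C"
    using spanning_forest[OF _ E'] CV fin finite_subset by metis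
  have "comps C E' = {C}"
  proof -
    have "C \<noteq> {}"
      using C comps_partition(2)[of V E] by metis
    moreover have "{y\<in>C. (x, y) \<in> conn E'} = C" if "x \<in> C" for x
      using con[OF that] by auto
    ultimately show ?thesis
      by (auto simp: comps_eq_image)
  qed
  then have "F \<in> trees C"
    using F E' con by (auto simp: trees_def)
  moreover have "F \<subseteq> E"
    using F by (auto simp: E'_def)
  ultimately show ?thesis by blast
qed

text \<open>A component of size at most \<open>K\<close> is counted at least once, through any of
  its spanning trees; the larger ones are disjoint, hence at most \<open>card V / K\<close> in
  number. A component with cycles is counted once per spanning tree, an excess that disappears in
  the limit.\<close>

lemma card_comps_le_trees:
  assumes fin: "finite V" and E: "E \<subseteq> edges_on V" and K: "0 < K"
  shows "real (card (comps V E)) \<le>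
    (\<Sum>k\<in>{1..K}. real (card {(S, T) \<in> set_trees V k. T \<subseteq> E \<and> (\<forall>e\<in>E. e \<inter> S \<noteq> {} \<longrightarrow> e \<subseteq> S)}))
      + real (card V) / real K"
proof -
  define Y where "Y = (\<lambda>k. {(S, T) \<in> set_trees V k. T \<subseteq> E \<and> (\<forall>e\<in>E. e \<inter> S \<noteq> {} \<longrightarrow> e \<subseteq> S)})"
  define D where "D = {C \<in> comps V E. K < card C}"
  have finC: "finite (comps V E)"
    using fin by (rule finite_comps)
  have CV: "C \<subseteq> V" "C \<noteq> {}" "finite C" if "C \<in> comps V E" for C
  proof -
    show "C \<subseteq> V" using that comps_partition(1)[of V E] by blast
    then show "finite C" using fin finite_subset by blast
    show "C \<noteq> {}" using that comps_partition(2)[of V E] by metis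
  qed
  have finY: "finite (Y k)" for k
    by (rule finite_subset[OF _ finite_set_trees[OF fin, of k]]) (auto simp: Y_def)
  have "comps V E \<subseteq> (\<Union>k\<in>{1..K}. fst ` Y k) \<union> D"
  proof
    fix C assume C: "C \<in> comps V E"
    show "C \<in> (\<Union>k\<in>{1..K}. fst ` Y k) \<union> D"
    proof (cases "K < card C")
      case True
      then show ?thesis using C by (simp add: D_def)
    next
      case False
      have "0 < card C"
        using CV[OF C] by (simp add: card_gt_0_iff)
      moreover obtain T where T: "T \<in> trees C" "T \<subseteq> E"
        using ex_tree_comp[OF fin E C] by blast
      moreover have "e \<subseteq> C" if eE: "e \<in> E" and eC: "e \<inter> C \<noteq> {}" for e
      proof -
        obtain x y where e: "e = {x, y}" "x \<in> V" "y \<in> V"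
          using edges_onE[OF subsetD[OF E eE]] by metis
        have "(x, y) \<in> conn E"
          using eE by (intro conn_edge) (simp add: e)
        moreover from this have "(y, x) \<in> conn E"
          by (rule conn_sym)
        moreover have "x \<in> C \<or> y \<in> C"
          using eC by (auto simp: e)
        ultimately have "x \<in> C \<and> y \<in> C"
          using e comps_closed[OF C, of x y] comps_closed[OF C, of y x] by metis
        then show ?thesis by (simp add: e)
      qed
      ultimately have "(C, T) \<in> Y (card C)" "card C \<in> {1..K}"
        using CV[OF C] False unfolding Y_def set_trees_def by simp_all
      then have "C \<in> (\<Union>k\<in>{1..K}. fst ` Y k)"
        by (metis UN_I fst_conv image_eqI)
      then show ?thesis by (rule UnI1)
    qed
  qed
  then have "card (comps V E) \<le> card ((\<Union>k\<in>{1..K}. fst ` Y k) \<union> D)"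
    using finY finC by (intro card_mono) (auto simp: D_def)
  also have "\<dots> \<le> card (\<Union>k\<in>{1..K}. fst ` Y k) + card D"
    by (rule card_Un_le)
  also have "card (\<Union>k\<in>{1..K}. fst ` Y k) \<le> (\<Sum>k\<in>{1..K}. card (fst ` Y k))"
    by (rule card_UN_le) simp
  also have "\<dots> \<le> (\<Sum>k\<in>{1..K}. card (Y k))"
    using finY by (intro sum_mono card_image_le)
  finally have 1: "card (comps V E) \<le> (\<Sum>k\<in>{1..K}. card (Y k)) + card D" by simp
  have "K * card D = (\<Sum>C\<in>D. K)"
    by simp
  also have "\<dots> \<le> (\<Sum>C\<in>D. card C)"
    by (rule sum_mono) (auto simp: D_def)
  also have "\<dots> = card (\<Union>D)"
    by (rule card_Union_disjoint[symmetric])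
       (auto simp: D_def pairwise_def disjnt_def CV dest: comps_partition(3))
  also have "\<dots> \<le> card V"
    using CV fin by (intro card_mono) (auto simp: D_def)
  finally have "real K * real (card D) \<le> real (card V)"
    by (metis of_nat_le_iff of_nat_mult)
  then have "real (card D) \<le> real (card V) / real K"
    using K by (simp add: field_simps)
  moreover have "real (card (comps V E)) \<le> (\<Sum>k\<in>{1..K}. real (card (Y k))) + real (card D)"
    using 1 by (metis of_nat_add of_nat_le_iff of_nat_sum)
  ultimately show ?thesis
    by (simp add: Y_def)
qed

text \<open>Here \<open>T\<close> is the set of all edges meeting \<open>S\<close>, so
  \<open>S\<close> determines \<open>T\<close> and is a component. Hence no component is counted
  twice.\<close>

lemma card_trees_le_comps:
  assumes fin: "finite V"
  shows "(\<Sum>k\<in>{1..K}. card {(S, T) \<in> set_trees V k. {e\<in>E. e \<inter> S \<noteq> {}} = T}) \<le> card (comps V E)"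
proof -
  define Y where "Y = (\<lambda>k. {(S, T) \<in> set_trees V k. {e\<in>E. e \<inter> S \<noteq> {}} = T})"
  have inj: "inj_on fst (Y k)" for k
    by (auto simp: Y_def inj_on_def)
  have finY: "finite (Y k)" for k
    by (rule finite_subset[OF _ finite_set_trees[OF fin, of k]]) (auto simp: Y_def)
  have comp: "S \<in> comps V E \<and> card S = k" if SY: "S \<in> fst ` Y k" and k: "k \<in> {1..K}" for S k
  proof -
    obtain T where "(S, T) \<in> Y k"
      using SY by auto
    then have S: "S \<subseteq> V" "card S = k" "T \<subseteq> edges_on S" "S \<times> S \<subseteq> conn T" "T = {e\<in>E. e \<inter> S \<noteq> {}}"
      by (auto simp: Y_def set_trees_def trees_def)
    then obtain x where x: "x \<in> S"
      using k by fastforce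
    have "y \<in> S" if "(x, y) \<in> conn E" for y
      using that unfolding conn_def
    proof (induction rule: rtrancl_induct)
      case (step y z)
      then have "{y, z} \<in> T"
        using S(5) by auto
      then show ?case using S(3) by auto
    qed (rule x)
    moreover have "conn T \<subseteq> conn E"
      using S(5) by (intro conn_mono) auto
    ultimately have "S = {y\<in>V. (x, y) \<in> conn E}"
      using S(1,4) x by blast
    then show ?thesis
      using S(1,2) x unfolding comps_iff by blast
  qed
  have "(\<Sum>k\<in>{1..K}. card (Y k)) = (\<Sum>k\<in>{1..K}. card (fst ` Y k))"
    by (simp add: card_image[OF inj])
  also have "\<dots> = card (\<Union>k\<in>{1..K}. fst ` Y k)"
  proof (rule card_UN_disjoint[symmetric])
    show "\<forall>i\<in>{1..K}. \<forall>j\<in>{1..K}. i \<noteq> j \<longrightarrow> fst ` Y i \<inter> fst ` Y j = {}"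
      using comp by (metis disjoint_iff)
  qed (use finY in auto)
  also have "\<dots> \<le> card (comps V E)"
    using comp by (intro card_mono finite_comps fin) blast
  finally show ?thesis by (simp add: Y_def)
qed

section \<open>Averages over graphs\<close>

lemma graphs_eq: "graphs n m = {E. E \<subseteq> edges_on {..<n} \<and> card E = m}"
  by (simp add: graphs_def all_edges_eq)

lemma finite_graphs [simp]: "finite (graphs n m)"
  by (rule finite_subset[of _ "Pow (edges_on {..<n})"]) (auto simp: graphs_eq)

lemma card_graphs: "card (graphs n m) = (n choose 2) choose m"
  unfolding graphs_eq by (subst n_subsets) (simp_all add: card_edges_on)

text \<open>The expectation over \<open>random_graph n m\<close> as a finite sum. If
  \<open>m > n choose 2\<close>, the denominator is 0 and so is the value, hence the bound on
  \<open>m\<close> in \<open>mean_const\<close>.\<close>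

definition mean :: "nat \<Rightarrow> nat \<Rightarrow> (nat set set \<Rightarrow> real) \<Rightarrow> real" where
  "mean n m f = (\<Sum>E\<in>graphs n m. f E) / real ((n choose 2) choose m)"

lemma mean_mono: "(\<And>E. E \<in> graphs n m \<Longrightarrow> f E \<le> g E) \<Longrightarrow> mean n m f \<le> mean n m g"
  unfolding mean_def by (intro divide_right_mono sum_mono) auto

lemma mean_add: "mean n m (\<lambda>E. f E + g E) = mean n m f + mean n m g"
  by (simp add: mean_def sum.distrib add_divide_distrib)

lemma mean_cmult: "mean n m (\<lambda>E. c * f E) = c * mean n m f"
  by (simp add: mean_def sum_distrib_left)

lemma mean_sum: "mean n m (\<lambda>E. \<Sum>x\<in>X. f x E) = (\<Sum>x\<in>X. mean n m (f x))"
  unfolding mean_def by (subst sum.swap) (simp add: sum_divide_distrib)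

lemma mean_const: "m \<le> n choose 2 \<Longrightarrow> mean n m (\<lambda>E. c) = c"
  by (simp add: mean_def card_graphs)

lemma f_cut_eq_mean:
  assumes "m \<le> n choose 2"
  shows "f_cut n m = mean n m (\<lambda>E. real (max_cut n E))"
proof -
  have "card (graphs n m) > 0"
    using assms by (simp add: card_graphs)
  then have "graphs n m \<noteq> {}" by auto
  then show ?thesis
    by (simp add: f_cut_def random_graph_def integral_pmf_of_set mean_def card_graphs)
qed

lemma card_sets_between:
  assumes "finite A" "finite W" "A \<inter> W = {}" "card A \<le> m"
  shows "card {E. A \<subseteq> E \<and> E \<subseteq> A \<union> W \<and> card E = m} = card W choose (m - card A)"
proof -
  have "bij_betw (\<lambda>F. A \<union> F) {F. F \<subseteq> W \<and> card F = m - card A}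
          {E. A \<subseteq> E \<and> E \<subseteq> A \<union> W \<and> card E = m}"
  proof (rule bij_betw_byWitness[where f' = "\<lambda>E. E - A"])
    show "(\<lambda>F. A \<union> F) ` {F. F \<subseteq> W \<and> card F = m - card A} \<subseteq>
        {E. A \<subseteq> E \<and> E \<subseteq> A \<union> W \<and> card E = m}"
    proof clarsimp
      fix F assume F: "F \<subseteq> W" "card F = m - card A"
      then have "card (A \<union> F) = card A + card F"
        using assms finite_subset by (intro card_Un_disjoint) auto
      then show "F \<subseteq> A \<union> W \<and> card (A \<union> F) = m"
        using F assms by auto
    qed
    show "(\<lambda>E. E - A) ` {E. A \<subseteq> E \<and> E \<subseteq> A \<union> W \<and> card E = m} \<subseteq> {F. F \<subseteq> W \<and> card F = m - card A}"
      using assms by (auto simp: card_Diff_subset)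
  qed (use assms in auto)
  then show ?thesis
    unfolding n_subsets[OF assms(2), symmetric] by (rule bij_betw_same_card[symmetric])
qed

lemma sum_card_swap:
  assumes "finite A" "finite B"
  shows "(\<Sum>a\<in>A. card {b\<in>B. P a b}) = (\<Sum>b\<in>B. card {a\<in>A. P a b})"
proof -
  have "(\<Sum>a\<in>A. card {b\<in>B. P a b}) = (\<Sum>a\<in>A. \<Sum>b\<in>B. if P a b then 1 else 0)"
    using assms by (simp add: sum.If_cases Int_def)
  also have "\<dots> = (\<Sum>b\<in>B. \<Sum>a\<in>A. if P a b then 1 else 0)"
    by (rule sum.swap)
  also have "\<dots> = (\<Sum>b\<in>B. card {a\<in>A. P a b})"
    using assms by (simp add: sum.If_cases Int_def)
  finally show ?thesis .
qed

lemma mean_card: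
  assumes "finite X"
  shows "mean n m (\<lambda>E. real (card {x\<in>X. P x E})) =
     (\<Sum>x\<in>X. real (card {E \<in> graphs n m. P x E})) / real ((n choose 2) choose m)"
  unfolding mean_def of_nat_sum[symmetric] sum_card_swap[OF finite_graphs assms] ..

text \<open>The probability that a given tree on \<open>k\<close> vertices is present and cut off
  from the rest: \<open>k - 1\<close> edges are prescribed, the others come from the pairs outside
  the tree's vertex set and from \<open>b\<close> further pairs. \<open>b = 0\<close> means an
  isolated tree; \<open>b = (k choose 2) - (k - 1)\<close> allows extra edges inside.\<close>

definition tree_prob :: "nat \<Rightarrow> nat \<Rightarrow> nat \<Rightarrow> nat \<Rightarrow> real" where
  "tree_prob b k n m = real ((((n - k) choose 2) + b) choose (m - (k - 1))) / real ((n choose 2) choose m)"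

definition n_trees :: "nat \<Rightarrow> nat \<Rightarrow> real" where
  "n_trees k n = real (card (set_trees {..<n} k))"

lemma set_treesD:
  assumes "(S, T) \<in> set_trees {..<n} k"
  shows "S \<subseteq> {..<n}" "finite S" "card S = k" "T \<subseteq> edges_on S" "finite T" "card T = k - 1"
    "T \<subseteq> edges_on {..<n}" "card ({..<n} - S) = n - k"
proof -
  show S: "S \<subseteq> {..<n}" "card S = k" "T \<subseteq> edges_on S" "card T = k - 1"
    using assms by (auto simp: set_trees_def trees_def)
  show "finite S"
    using S(1) finite_subset by blast
  then show "finite T"
    using S(3) finite_subset by blast
  show "T \<subseteq> edges_on {..<n}"
    using S(1,3) edges_on_mono by blast
  show "card ({..<n} - S) = n - k"
    using S \<open>finite S\<close> by (simp add: card_Diff_subset)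
qed

lemma edges_onD: "e \<in> edges_on S \<Longrightarrow> e \<subseteq> S" "e \<in> edges_on S \<Longrightarrow> e \<inter> S \<noteq> {}"
  by (auto elim!: edges_onE)

text \<open>Once all edges meeting \<open>S\<close> are prescribed, the remaining
  \<open>m - (k - 1)\<close> edges range freely over the pairs that avoid \<open>S\<close>.\<close>

lemma mean_isolated_trees:
  assumes "k - 1 \<le> m"
  shows "mean n m (\<lambda>E. real (card {(S, T) \<in> set_trees {..<n} k. {e\<in>E. e \<inter> S \<noteq> {}} = T})) =
    n_trees k n * tree_prob 0 k n m"
proof -
  have "card {E \<in> graphs n m. {e\<in>E. e \<inter> S \<noteq> {}} = T} = ((n - k) choose 2) choose (m - (k - 1))"
    if "(S, T) \<in> set_trees {..<n} k" for S T
  proof -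
    note ST = set_treesD[OF that]
    define W where "W = edges_on ({..<n} - S)"
    have TS: "e \<inter> S \<noteq> {}" if "e \<in> T" for e
      using edges_onD[OF subsetD[OF ST(4) that]] by auto
    have W: "e \<in> W \<longleftrightarrow> e \<in> edges_on {..<n} \<and> e \<inter> S = {}" for e
      by (auto simp: W_def edges_on_def)
    have "{E \<in> graphs n m. {e\<in>E. e \<inter> S \<noteq> {}} = T} = {E. T \<subseteq> E \<and> E \<subseteq> T \<union> W \<and> card E = m}"
      using TS W ST(7) unfolding graphs_eq by blast
    also have "card \<dots> = card W choose (m - card T)"
      using TS W ST assms by (intro card_sets_between) (auto simp: W_def)
    also have "card W = (n - k) choose 2"
      by (simp add: W_def card_edges_on ST)
    finally show ?thesis by (simp add: ST)
  qed
  then have *: "card {E \<in> graphs n m. case x of (S, T) \<Rightarrow> {e\<in>E. e \<inter> S \<noteq> {}} = T} =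
      ((n - k) choose 2) choose (m - (k - 1))" if "x \<in> set_trees {..<n} k" for x
    using that by (cases x) auto
  have "{(S, T) \<in> set_trees {..<n} k. {e\<in>E. e \<inter> S \<noteq> {}} = T} =
        {x \<in> set_trees {..<n} k. case x of (S, T) \<Rightarrow> {e\<in>E. e \<inter> S \<noteq> {}} = T}" for E
    by auto
  then show ?thesis
    by (simp add: mean_card finite_set_trees * n_trees_def tree_prob_def)
qed

text \<open>As for isolated trees, but the pairs inside \<open>S\<close> that are not in
  \<open>T\<close> become optional and enlarge the free set \<open>W\<close>.\<close>

lemma mean_separated_trees:
  assumes "k - 1 \<le> m"
  shows "mean n m (\<lambda>E. real (card {(S, T) \<in> set_trees {..<n} k. T \<subseteq> E \<and> (\<forall>e\<in>E. e \<inter> S \<noteq> {} \<longrightarrow> e \<subseteq> S)})) =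
    n_trees k n * tree_prob ((k choose 2) - (k - 1)) k n m"
proof -
  have "card {E \<in> graphs n m. T \<subseteq> E \<and> (\<forall>e\<in>E. e \<inter> S \<noteq> {} \<longrightarrow> e \<subseteq> S)} =
      (((n - k) choose 2) + ((k choose 2) - (k - 1))) choose (m - (k - 1))"
    if "(S, T) \<in> set_trees {..<n} k" for S T
  proof -
    note ST = set_treesD[OF that]
    define W where "W = edges_on ({..<n} - S) \<union> (edges_on S - T)"
    have TS: "e \<inter> S \<noteq> {}" "e \<subseteq> S" if "e \<in> T" for e
      using edges_onD[OF subsetD[OF ST(4) that]] by auto
    have W: "e \<in> W \<longleftrightarrow> e \<in> edges_on {..<n} \<and> e \<notin> T \<and> (e \<inter> S \<noteq> {} \<longrightarrow> e \<subseteq> S)" for e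
      using ST(1) TS[of e] unfolding W_def edges_on_def by blast
    have "{E \<in> graphs n m. T \<subseteq> E \<and> (\<forall>e\<in>E. e \<inter> S \<noteq> {} \<longrightarrow> e \<subseteq> S)} =
        {E. T \<subseteq> E \<and> E \<subseteq> T \<union> W \<and> card E = m}"
    proof (intro Collect_cong iffI)
      fix E assume "E \<in> graphs n m \<and> T \<subseteq> E \<and> (\<forall>e\<in>E. e \<inter> S \<noteq> {} \<longrightarrow> e \<subseteq> S)"
      then show "T \<subseteq> E \<and> E \<subseteq> T \<union> W \<and> card E = m"
        by (auto simp: graphs_eq W)
    next
      fix E assume E: "T \<subseteq> E \<and> E \<subseteq> T \<union> W \<and> card E = m"
      then have "e \<in> edges_on {..<n} \<and> (e \<inter> S \<noteq> {} \<longrightarrow> e \<subseteq> S)" if "e \<in> E" for e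
        using that W[of e] TS(2)[of e] ST(7) by blast
      with E show "E \<in> graphs n m \<and> T \<subseteq> E \<and> (\<forall>e\<in>E. e \<inter> S \<noteq> {} \<longrightarrow> e \<subseteq> S)"
        unfolding graphs_eq by blast
    qed
    also have "card \<dots> = card W choose (m - card T)"
      using W ST assms by (intro card_sets_between) (auto simp: W_def)
    also have "card W = card (edges_on ({..<n} - S)) + card (edges_on S - T)"
      unfolding W_def
    proof (intro card_Un_disjoint)
      show "edges_on ({..<n} - S) \<inter> (edges_on S - T) = {}"
        by (blast dest: edges_onD)
    qed (use ST in auto)
    also have "\<dots> = ((n - k) choose 2) + ((k choose 2) - (k - 1))"
      using ST by (simp add: card_edges_on card_Diff_subset)
    finally show ?thesis by (simp add: ST)
  qed
  then have *: "card {E \<in> graphs n m. case x of (S, T) \<Rightarrow> T \<subseteq> E \<and> (\<forall>e\<in>E. e \<inter> S \<noteq> {} \<longrightarrow> e \<subseteq> S)} =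
      (((n - k) choose 2) + ((k choose 2) - (k - 1))) choose (m - (k - 1))"
      if "x \<in> set_trees {..<n} k" for x
    using that by (cases x) auto
  have "{(S, T) \<in> set_trees {..<n} k. T \<subseteq> E \<and> (\<forall>e\<in>E. e \<inter> S \<noteq> {} \<longrightarrow> e \<subseteq> S)} =
        {x \<in> set_trees {..<n} k. case x of (S, T) \<Rightarrow> T \<subseteq> E \<and> (\<forall>e\<in>E. e \<inter> S \<noteq> {} \<longrightarrow> e \<subseteq> S)}" for E
    by auto
  then show ?thesis
    by (simp add: mean_card finite_set_trees * n_trees_def tree_prob_def)
qed

abbreviation n_comps :: "nat \<Rightarrow> nat set set \<Rightarrow> real" where
  "n_comps n E \<equiv> real (card (comps {..<n} E))"

lemma mean_comps_le_trees:
  assumes "0 < K" "K \<le> m" "m \<le> n choose 2"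
  shows "mean n m (n_comps n) \<le>
     (\<Sum>k\<in>{1..K}. n_trees k n * tree_prob ((k choose 2) - (k - 1)) k n m) + real n / real K"
proof -
  have "mean n m (n_comps n) \<le> mean n m (\<lambda>E. (\<Sum>k\<in>{1..K}. real (card {(S, T) \<in> set_trees {..<n} k.
            T \<subseteq> E \<and> (\<forall>e\<in>E. e \<inter> S \<noteq> {} \<longrightarrow> e \<subseteq> S)})) + real (card {..<n}) / real K)"
    by (intro mean_mono card_comps_le_trees) (use assms in \<open>auto simp: graphs_eq\<close>)
  also have "\<dots> = (\<Sum>k\<in>{1..K}. n_trees k n * tree_prob ((k choose 2) - (k - 1)) k n m) + real n / real K"
    unfolding mean_add mean_sum mean_const[OF assms(3)]
    by (intro arg_cong2[of _ _ _ _ "(+)"] sum.cong mean_separated_trees) (use assms in auto)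
  finally show ?thesis .
qed

lemma mean_comps_ge_trees:
  assumes "K \<le> m"
  shows "(\<Sum>k\<in>{1..K}. n_trees k n * tree_prob 0 k n m) \<le> mean n m (n_comps n)"
proof -
  have "(\<Sum>k\<in>{1..K}. n_trees k n * tree_prob 0 k n m) =
      (\<Sum>k\<in>{1..K}. mean n m (\<lambda>E. real (card {(S, T) \<in> set_trees {..<n} k. {e\<in>E. e \<inter> S \<noteq> {}} = T})))"
    by (intro sum.cong mean_isolated_trees[symmetric]) (use assms in auto)
  also have "\<dots> = mean n m (\<lambda>E. real (\<Sum>k\<in>{1..K}. card {(S, T) \<in> set_trees {..<n} k. {e\<in>E. e \<inter> S \<noteq> {}} = T}))"
    unfolding of_nat_sum mean_sum ..
  also have "\<dots> \<le> mean n m (n_comps n)"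
    by (intro mean_mono of_nat_mono card_trees_le_comps) simp
  finally show ?thesis .
qed

lemma mean_comps_ge:
  assumes "m \<le> n choose 2"
  shows "real n - real m \<le> mean n m (n_comps n)"
proof -
  have "mean n m (\<lambda>E. real n - real m) \<le> mean n m (n_comps n)"
  proof (rule mean_mono)
    fix E assume "E \<in> graphs n m"
    then show "real n - real m \<le> n_comps n E"
      using card_comps_ge[of "{..<n}" E] by (simp add: graphs_eq)
  qed
  then show ?thesis by (simp add: mean_const assms)
qed

lemma mean_comps_le: "m \<le> n choose 2 \<Longrightarrow> mean n m (n_comps n) \<le> real n"
  using mean_mono[of n m "n_comps n" "\<lambda>_. real n"] card_comps_le[of "{..<n}"]
  by (simp add: mean_const)

section \<open>Few cycles below the threshold\<close>

text \<open>Bounds the probability that \<open>l\<close> given edges are all present: it is a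
  product of factors \<open>(m - i) / (N - i)\<close>, each at most \<open>m / N\<close>.\<close>

lemma binomial_ratio_le:
  assumes "l \<le> m" "m \<le> N"
  shows "real ((N - l) choose (m - l)) \<le> (real m / real N) ^ l * real (N choose m)"
  using assms
proof (induction l arbitrary: m N)
  case (Suc l)
  obtain m' N' where mN: "m = Suc m'" "N = Suc N'"
    using Suc.prems by (cases m; cases N) auto
  have "real (Suc N' choose Suc m') * real (Suc m') = real (Suc N') * real (N' choose m')"
    using Suc_times_binomial_eq[of N' m'] by (metis of_nat_mult mult.commute)
  then have eq: "real (N' choose m') = real m / real N * real (N choose m)"
    by (simp add: mN field_simps del: of_nat_Suc binomial_Suc_Suc)
  have "real m' / real N' \<le> real m / real N"
    using Suc.prems by (cases "N' = 0") (auto simp: mN field_simps)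
  then have "(real m' / real N') ^ l \<le> (real m / real N) ^ l"
    by (intro power_mono) auto
  then have "(real m' / real N') ^ l * real (N' choose m') \<le> (real m / real N) ^ l * real (N' choose m')"
    by (intro mult_right_mono) auto
  moreover have "real ((N' - l) choose (m' - l)) \<le> (real m' / real N') ^ l * real (N' choose m')"
    using Suc by (auto simp: mN)
  moreover have "(real m / real N) ^ Suc l * real (N choose m) = (real m / real N) ^ l * real (N' choose m')"
    unfolding eq by (simp only: power_Suc mult_ac)
  moreover have "(N - Suc l) choose (m - Suc l) = (N' - l) choose (m' - l)"
    by (simp add: mN)
  ultimately show ?case
    by linarith
qed simp

text \<open>There are at most \<open>n ^ l\<close> lists of length \<open>l\<close>, each a cycle
  with probability at most \<open>(m / N) ^ l\<close>. This is a geometric series of ratio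
  \<open>q\<close>, which tends to the average degree; the bound is free of \<open>n\<close>
  precisely below the threshold.\<close>

lemma mean_cycles_le:
  assumes m: "m \<le> n choose 2" and q: "q = real n * real m / real (n choose 2)" "q < 1"
  shows "mean n m (\<lambda>E. real (card (cycles {..<n} E))) \<le> 1 / (1 - q)"
proof -
  define N where "N = n choose 2"
  define X where "X = {xs. distinct xs \<and> set xs \<subseteq> {..<n} \<and> 3 \<le> length xs}"
  have finX: "finite X"
    by (rule finite_subset[OF _ finite_subset_distinct[of "{..<n}"]]) (auto simp: X_def)
  have q0: "0 \<le> q"
    by (simp add: q(1))
  have count: "real (card {E \<in> graphs n m. cycle_edges xs \<subseteq> E}) \<le>
      (real m / real N) ^ length xs * real (N choose m)" if "xs \<in> X" for xs
  proof -
    let ?A = "cycle_edges xs"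
    have xs: "distinct xs" "set xs \<subseteq> {..<n}" "3 \<le> length xs"
      using that by (auto simp: X_def)
    have A: "?A \<subseteq> edges_on {..<n}"
      using cycle_edges_edges_on[OF xs(1,3)] edges_on_mono[OF xs(2)] by blast
    have cA: "card ?A = length xs"
      using card_cycle_edges[OF xs(1,3)] .
    have finA: "finite ?A"
      using A finite_subset by blast
    show ?thesis
    proof (cases "length xs \<le> m")
      case True
      have "{E \<in> graphs n m. ?A \<subseteq> E} = {E. ?A \<subseteq> E \<and> E \<subseteq> ?A \<union> (edges_on {..<n} - ?A) \<and> card E = m}"
        using A unfolding graphs_eq by blast
      also have "card \<dots> = card (edges_on {..<n} - ?A) choose (m - card ?A)"
        using finA True cA by (intro card_sets_between) auto
      also have "\<dots> = (N - length xs) choose (m - length xs)"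
        using A finA by (simp add: card_Diff_subset card_edges_on cA N_def)
      finally show ?thesis
        using binomial_ratio_le[OF True, of N] m by (simp add: N_def)
    next
      \<comment> \<open>The truncated difference \<open>m - length xs\<close> would be 0 here and
        the binomial formula wrong; but a graph with \<open>m\<close> edges contains no longer
        cycle.\<close>
      case False
      have "\<not> ?A \<subseteq> E" if "E \<in> graphs n m" for E
      proof
        assume "?A \<subseteq> E"
        moreover have "finite E" "card E = m"
          using that finite_subset unfolding graphs_eq by blast+
        ultimately show False
          using False cA card_mono by metis
      qed
      then have "{E \<in> graphs n m. ?A \<subseteq> E} = {}"
        by blast
      then have "card {E \<in> graphs n m. ?A \<subseteq> E} = 0"
        by (simp only: card.empty)
      then show ?thesis
        by (simp only: of_nat_0) simp
    qed
  qed
  have "mean n m (\<lambda>E. real (card (cycles {..<n} E))) = mean n m (\<lambda>E. real (card {xs\<in>X. cycle_edges xs \<subseteq> E}))"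
    by (simp add: cycles_def X_def conj_assoc)
  also have "\<dots> = (\<Sum>xs\<in>X. real (card {E \<in> graphs n m. cycle_edges xs \<subseteq> E})) / real (N choose m)"
    unfolding N_def by (rule mean_card[OF finX])
  also have "\<dots> \<le> (\<Sum>xs\<in>X. (real m / real N) ^ length xs * real (N choose m)) / real (N choose m)"
    by (intro divide_right_mono sum_mono count) auto
  also have "\<dots> = (\<Sum>xs\<in>X. (real m / real N) ^ length xs)"
    using m by (simp add: sum_distrib_right[symmetric] N_def)
  also have "\<dots> = (\<Sum>l\<in>{..n}. \<Sum>xs\<in>{xs\<in>X. length xs = l}. (real m / real N) ^ length xs)"
  proof (rule sum.group[symmetric])
    show "length ` X \<subseteq> {..n}"
    proof clarsimp
      fix xs assume "xs \<in> X"
      then show "length xs \<le> n"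
        using card_mono[of "{..<n}" "set xs"] by (auto simp: X_def distinct_card)
    qed
  qed (use finX in auto)
  also have "\<dots> = (\<Sum>l\<in>{..n}. real (card {xs\<in>X. length xs = l}) * (real m / real N) ^ l)"
    by (intro sum.cong refl) simp
  also have "\<dots> \<le> (\<Sum>l\<in>{..n}. real (n ^ l) * (real m / real N) ^ l)"
  proof (intro sum_mono mult_right_mono)
    fix l
    have "card {xs\<in>X. length xs = l} \<le> card {xs. set xs \<subseteq> {..<n} \<and> length xs = l}"
      by (intro card_mono finite_lists_length_eq) (auto simp: X_def)
    then show "real (card {xs\<in>X. length xs = l}) \<le> real (n ^ l)"
      by (simp only: of_nat_le_iff) (simp add: card_lists_length_eq)
  qed auto
  also have "\<dots> = (\<Sum>l\<in>{..n}. q ^ l)"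
    by (simp add: q(1) N_def power_mult_distrib power_divide)
  also have "\<dots> \<le> (\<Sum>l. q ^ l)"
    using q0 q(2) by (intro sum_le_suminf summable_geometric) auto
  also have "\<dots> = 1 / (1 - q)"
    using q0 q(2) by (intro suminf_geometric) auto
  finally show ?thesis .
qed

lemma mean_comps_le_subcritical:
  assumes m: "m \<le> n choose 2" and q: "q = real n * real m / real (n choose 2)" "q < 1"
  shows "mean n m (n_comps n) \<le> real n - real m + 1 / (1 - q)"
proof -
  have "mean n m (n_comps n) \<le> mean n m (\<lambda>E. (real n - real m) + real (card (cycles {..<n} E)))"
  proof (rule mean_mono)
    fix E assume "E \<in> graphs n m"
    then show "n_comps n E \<le> (real n - real m) + real (card (cycles {..<n} E))"
      using card_comps_le_cycles[of "{..<n}" E] by (simp add: graphs_eq)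
  qed
  also have "\<dots> = real n - real m + mean n m (\<lambda>E. real (card (cycles {..<n} E)))"
    by (simp add: mean_add mean_const m)
  finally show ?thesis
    using mean_cycles_le[OF assms] by simp
qed

section \<open>Asymptotics of the number of tree components\<close>

text \<open>Squeeze by \<open>exp (- y / (1 - y)) \<le> 1 - y \<le> exp (- y)\<close> raised to the
  power \<open>r n\<close>.\<close>

lemma tendsto_one_minus_power:
  fixes y :: "nat \<Rightarrow> real" and r :: "nat \<Rightarrow> nat"
  assumes y: "y \<longlonglongrightarrow> 0" and ry: "(\<lambda>n. real (r n) * y n) \<longlonglongrightarrow> l"
    and nonneg: "\<forall>\<^sub>F n in sequentially. 0 \<le> y n"
  shows "(\<lambda>n. (1 - y n) ^ r n) \<longlonglongrightarrow> exp (- l)"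
proof (rule tendsto_sandwich)
  have "(\<lambda>n. exp (- (real (r n) * y n / (1 - y n)))) \<longlonglongrightarrow> exp (- (l / (1 - 0)))"
    by (intro tendsto_intros y ry) auto
  then show "(\<lambda>n. exp (- (real (r n) * y n / (1 - y n)))) \<longlonglongrightarrow> exp (- l)"
    by simp
  show "(\<lambda>n. exp (- (real (r n) * y n))) \<longlonglongrightarrow> exp (- l)"
    by (intro tendsto_intros ry)
  have less: "\<forall>\<^sub>F n in sequentially. y n < 1"
    using order_tendstoD(2)[OF y, of 1] by simp
  show "\<forall>\<^sub>F n in sequentially. exp (- (real (r n) * y n / (1 - y n))) \<le> (1 - y n) ^ r n"
    using less
  proof eventually_elim
    case (elim n)
    have "1 / (1 - y n) = 1 + y n / (1 - y n)"
      using elim by (simp add: field_simps)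
    also have "\<dots> \<le> exp (y n / (1 - y n))"
      by (rule exp_ge_add_one_self)
    finally have "exp (- (y n / (1 - y n))) \<le> 1 - y n"
      using elim by (simp add: exp_minus field_simps)
    then have "exp (- (y n / (1 - y n))) ^ r n \<le> (1 - y n) ^ r n"
      by (intro power_mono) auto
    then show ?case
      by (simp add: exp_of_nat_mult[symmetric])
  qed
  show "\<forall>\<^sub>F n in sequentially. (1 - y n) ^ r n \<le> exp (- (real (r n) * y n))"
    using less
  proof eventually_elim
    case (elim n)
    have "(1 - y n) ^ r n \<le> exp (- y n) ^ r n"
      using elim exp_ge_add_one_self[of "- y n"] by (intro power_mono) auto
    then show ?case
      by (simp add: exp_of_nat_mult[symmetric])
  qed
qed

text \<open>The quotient of the binomials is a product of \<open>(M - i) / (N - i)\<close> over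
  \<open>i < r\<close>. These factors decrease in \<open>i\<close>, so the one at
  \<open>i = 0\<close> bounds them above.\<close>

lemma binomial_le_power_ratio:
  assumes "M \<le> N"
  shows "real (M choose r) \<le> (real M / real N) ^ r * real (N choose r)"
  using assms
proof (induction r arbitrary: M N)
  case (Suc r)
  show ?case
  proof (cases M)
    case M: (Suc M')
    then obtain N' where N: "N = Suc N'"
      using Suc.prems by (cases N) auto
    have abs: "real (Suc L choose Suc r) = real (Suc L) * real (L choose r) / real (Suc r)" for L
    proof -
      have "real (Suc L choose Suc r) * real (Suc r) = real (Suc L) * real (L choose r)"
        using Suc_times_binomial_eq[of L r] by (metis of_nat_mult mult.commute)
      then show ?thesis
        by (simp add: field_simps del: of_nat_Suc binomial_Suc_Suc)
    qed
    have "real M' / real N' \<le> real M / real N"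
      using Suc.prems M N by (cases "N' = 0") (auto simp: field_simps)
    then have "(real M' / real N') ^ r * real (N' choose r) \<le> (real M / real N) ^ r * real (N' choose r)"
      by (intro mult_right_mono power_mono) auto
    moreover have "real (M' choose r) \<le> (real M' / real N') ^ r * real (N' choose r)"
      using Suc M N by auto
    ultimately have "real (M' choose r) \<le> (real M / real N) ^ r * real (N' choose r)"
      by simp
    then have "real M * real (M' choose r) / real (Suc r) \<le>
        real M * ((real M / real N) ^ r * real (N' choose r)) / real (Suc r)"
      by (intro divide_right_mono mult_left_mono) auto
    also have "\<dots> = (real M / real N) ^ Suc r * (real N * real (N' choose r) / real (Suc r))"
      using N by simp
    finally show ?thesis
      using abs[of M'] abs[of N'] M N by simp
  qed simp
qed simp

text \<open>Counterpart of the upper bound: all factors \<open>(M - i) / (N - i)\<close> with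
  \<open>i < r\<close> are at least the value at \<open>i = r\<close>.\<close>

lemma binomial_ge_power_ratio:
  assumes "r \<le> M" "M \<le> N" "r < N"
  shows "((real M - real r) / (real N - real r)) ^ r * real (N choose r) \<le> real (M choose r)"
  using assms
proof (induction r arbitrary: M N)
  case (Suc r)
  obtain M' N' where M: "M = Suc M'" and N: "N = Suc N'"
    using Suc.prems by (cases M; cases N) auto
  have abs: "real (Suc L choose Suc r) = real (Suc L) * real (L choose r) / real (Suc r)" for L
  proof -
    have "real (Suc L choose Suc r) * real (Suc r) = real (Suc L) * real (L choose r)"
      using Suc_times_binomial_eq[of L r] by (metis of_nat_mult mult.commute)
    then show ?thesis
      by (simp add: field_simps del: of_nat_Suc binomial_Suc_Suc)
  qed
  define q where "q = (real M' - real r) / (real N' - real r)"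
  have r: "real r \<le> real M'" "real M' \<le> real N'" "real r < real N'"
    using Suc.prems M N by auto
  have q0: "0 \<le> q"
    using r by (simp add: q_def)
  have qN: "q * real N \<le> real M"
  proof -
    have "(real M' - real r) * (real N' + 1) \<le> (real M' + 1) * (real N' - real r)"
    proof -
      have "(real M' + 1) * (real N' - real r) - (real M' - real r) * (real N' + 1) =
          (real N' - real M') * (real r + 1)"
        by (simp add: algebra_simps)
      moreover have "0 \<le> (real N' - real M') * (real r + 1)"
        using r by (intro mult_nonneg_nonneg) auto
      ultimately show ?thesis by linarith
    qed
    then show ?thesis
      using r by (simp add: q_def M N field_simps)
  qed
  have "q ^ r * real (N' choose r) \<le> real (M' choose r)"
    using Suc.IH[of M' N'] Suc.prems M N by (simp add: q_def)
  then have "(q * real N) * (q ^ r * real (N' choose r)) \<le> real M * real (M' choose r)"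
    using q0 qN by (intro mult_mono) auto
  then have "(q * real N) * (q ^ r * real (N' choose r)) / real (Suc r) \<le> real M * real (M' choose r) / real (Suc r)"
    by (rule divide_right_mono) simp
  moreover have "(real M - real (Suc r)) / (real N - real (Suc r)) = q"
    by (simp add: q_def M N)
  moreover have "(q * real N) * (q ^ r * real (N' choose r)) / real (Suc r) = q ^ Suc r * real (N choose Suc r)"
    unfolding N abs[of N'] by simp
  moreover have "real M * real (M' choose r) / real (Suc r) = real (M choose Suc r)"
    unfolding M abs[of M'] ..
  ultimately show ?case by metis
qed simp

text \<open>Iterated absorption. It separates the prescribed edges (the two products) from the
  choice of the remaining ones.\<close>

lemma binomial_absorption_prod:
  assumes "a \<le> m" "m \<le> N"
  shows "real (N choose m) * (\<Prod>i<a. real m - real i) =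
    (\<Prod>i<a. real N - real i) * real ((N - a) choose (m - a))"
  using assms
proof (induction a)
  case (Suc a)
  define m' N' where "m' = m - Suc a" and "N' = N - Suc a"
  have m': "m - a = Suc m'" "N - a = Suc N'"
    using Suc.prems by (auto simp: m'_def N'_def)
  have "real (Suc N' choose Suc m') * real (Suc m') = real (Suc N') * real (N' choose m')"
    using Suc_times_binomial_eq[of N' m'] by (metis of_nat_mult mult.commute)
  moreover have "real (Suc m') = real m - real a" "real (Suc N') = real N - real a"
    using Suc.prems m' by (metis Suc_leD of_nat_diff, metis Suc_leD le_trans of_nat_diff)
  ultimately have *: "real ((N - a) choose (m - a)) * (real m - real a) =
      (real N - real a) * real ((N - Suc a) choose (m - Suc a))"
    by (simp add: m' m'_def[symmetric] N'_def[symmetric])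
  have "real (N choose m) * (\<Prod>i<Suc a. real m - real i) =
      (real (N choose m) * (\<Prod>i<a. real m - real i)) * (real m - real a)"
    by simp
  also have "\<dots> = (\<Prod>i<a. real N - real i) * (real ((N - a) choose (m - a)) * (real m - real a))"
    using Suc by simp
  finally show ?case
    unfolding * by simp
qed simp

lemma real_choose_2: "real (n choose 2) = real n * (real n - 1) / 2"
proof (cases n)
  case (Suc k)
  show ?thesis
    by (auto simp: choose_two real_of_nat_div Suc algebra_simps)
qed simp

lemma choose_2_ratio: "(\<lambda>n. real (n choose 2) / real n ^ 2) \<longlonglongrightarrow> 1 / 2"
proof -
  have "(\<lambda>n. (1 - 1 / real n) / 2) \<longlonglongrightarrow> (1 - 0) / 2"
    by (intro tendsto_intros lim_1_over_n) auto
  then have "(\<lambda>n. (1 - 1 / real n) / 2) \<longlonglongrightarrow> 1 / 2"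
    by simp
  then show ?thesis
  proof (rule Lim_transform_eventually)
    show "\<forall>\<^sub>F n in sequentially. (1 - 1 / real n) / 2 = real (n choose 2) / (real n)\<^sup>2"
      using eventually_gt_at_top[of 0]
      by eventually_elim (simp add: real_choose_2 field_simps power2_eq_square)
  qed
qed

lemma linear_over_square:
  assumes "(\<lambda>n. f n / real n) \<longlonglongrightarrow> c"
  shows "(\<lambda>n. f n / real n ^ 2) \<longlonglongrightarrow> 0"
proof -
  have "(\<lambda>n. f n / real n * (1 / real n)) \<longlonglongrightarrow> c * 0"
    by (intro tendsto_intros assms lim_1_over_n)
  then show ?thesis by (simp add: power2_eq_square)
qed

lemma eventually_le_choose_2:
  assumes "(\<lambda>n. real (m n) / real n) \<longlonglongrightarrow> c"
  shows "\<forall>\<^sub>F n in sequentially. m n \<le> n choose 2"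
proof -
  have "(\<lambda>n. real (n choose 2) / real n ^ 2 - real (m n) / real n ^ 2) \<longlonglongrightarrow> 1 / 2 - 0"
    by (intro tendsto_intros choose_2_ratio linear_over_square[OF assms])
  then have "\<forall>\<^sub>F n in sequentially. 0 < real (n choose 2) / real n ^ 2 - real (m n) / real n ^ 2"
    by (rule order_tendstoD) simp
  then show ?thesis
    using eventually_gt_at_top[of 0]
    by eventually_elim (simp add: diff_divide_distrib[symmetric] zero_less_divide_iff)
qed

lemma eventually_ge_const:
  assumes "(\<lambda>n. real (m n) / real n) \<longlonglongrightarrow> c" "0 < c"
  shows "\<forall>\<^sub>F n in sequentially. K \<le> m n"
proof -
  have "(\<lambda>n. real (m n) / real n - real K * (1 / real n)) \<longlonglongrightarrow> c - real K * 0"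
    by (intro tendsto_intros assms lim_1_over_n)
  then have "\<forall>\<^sub>F n in sequentially. 0 < real (m n) / real n - real K * (1 / real n)"
    by (rule order_tendstoD) (use assms in simp)
  then show ?thesis
    using eventually_gt_at_top[of 0]
    by eventually_elim (simp add: field_simps)
qed

text \<open>With \<open>a = k - 1\<close> prescribed edges the probability is the product of
  \<open>(m - i) / (N - i)\<close> over \<open>i < a\<close>, which after scaling by
  \<open>n ^ a\<close> tends to \<open>c ^ a\<close>, times the chance that the other
  \<open>r = m - a\<close> edges avoid the forbidden pairs. About \<open>k n\<close> of
  \<open>n\<^sup>2 / 2\<close> pairs are forbidden and \<open>r\<close> is about
  \<open>c n / 2\<close>, whence \<open>exp (- (c k))\<close>. The fixed \<open>b\<close> is of
  lower order and drops out.\<close>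

lemma tree_prob_limit:
  assumes m: "(\<lambda>n. real (m n) / real n) \<longlonglongrightarrow> c / 2" and c: "0 < c" and k: "1 \<le> k"
  shows "(\<lambda>n. real n ^ (k - 1) * tree_prob b k n (m n)) \<longlonglongrightarrow> c ^ (k - 1) * exp (- (c * real k))"
proof -
  define a where "a = k - 1"
  define N where "N = (\<lambda>n. n choose 2)"
  define M where "M = (\<lambda>n. ((n - k) choose 2) + b)"
  define r where "r = (\<lambda>n. m n - a)"
  \<comment> \<open>\<open>D\<close> is the number of forbidden pairs: those outside the tree that
    the remaining edges must avoid.\<close>
  define D where "D = (\<lambda>n. real (N n) - real a - real (M n))"
  have ev_m: "\<forall>\<^sub>F n in sequentially. m n \<le> N n"
    unfolding N_def by (rule eventually_le_choose_2[OF m])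
  have ev_a: "\<forall>\<^sub>F n in sequentially. a \<le> m n"
    using eventually_ge_const[OF m] c by simp
  have inv: "(\<lambda>n. x * (1 / real n)) \<longlonglongrightarrow> 0" for x
    using tendsto_mult[OF tendsto_const lim_1_over_n, of x] by simp
  have inv2: "(\<lambda>n. x / real n ^ 2) \<longlonglongrightarrow> 0" for x
    using inv[of x] by (intro linear_over_square[of _ 0]) simp
  have N2: "(\<lambda>n. real (N n) / real n ^ 2) \<longlonglongrightarrow> 1 / 2"
    unfolding N_def by (rule choose_2_ratio)
  have m2: "(\<lambda>n. real (m n) / real n ^ 2) \<longlonglongrightarrow> 0"
    by (rule linear_over_square[OF m])
  have Na2: "(\<lambda>n. (real (N n) - real a) / real n ^ 2) \<longlonglongrightarrow> 1 / 2"
    using tendsto_diff[OF N2 inv2[of "real a"]] by (simp add: diff_divide_distrib)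
  have Nm2: "(\<lambda>n. (real (N n) - real (m n)) / real n ^ 2) \<longlonglongrightarrow> 1 / 2"
    using tendsto_diff[OF N2 m2] by (simp add: diff_divide_distrib)
  have Dn: "(\<lambda>n. D n / real n) \<longlonglongrightarrow> real k"
  proof -
    have "(\<lambda>n. real k - (real k * (real k + 1) / 2 + real a + real b) * (1 / real n)) \<longlonglongrightarrow> real k - 0"
      by (intro tendsto_diff tendsto_const inv)
    then have "(\<lambda>n. real k - (real k * (real k + 1) / 2 + real a + real b) * (1 / real n)) \<longlonglongrightarrow> real k"
      by simp
    then show ?thesis
    proof (rule Lim_transform_eventually)
      show "\<forall>\<^sub>F n in sequentially. real k - (real k * (real k + 1) / 2 + real a + real b) * (1 / real n) = D n / real n"
        using eventually_ge_at_top[of k] eventually_gt_at_top[of 0]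
      proof eventually_elim
        case (elim n)
        have "D n = real n * real k - (real k * (real k + 1) / 2 + real a + real b)"
          using elim by (simp add: D_def N_def M_def real_choose_2 of_nat_diff field_simps)
        then show ?case
          using elim(2) by (simp add: diff_divide_distrib)
      qed
    qed
  qed
  have rn: "(\<lambda>n. real (r n) / real n) \<longlonglongrightarrow> c / 2"
  proof -
    have "(\<lambda>n. real (m n) / real n - real a * (1 / real n)) \<longlonglongrightarrow> c / 2 - 0"
      by (intro tendsto_diff m inv)
    then have "(\<lambda>n. real (m n) / real n - real a * (1 / real n)) \<longlonglongrightarrow> c / 2"
      by simp
    then show ?thesis
    proof (rule Lim_transform_eventually)
      show "\<forall>\<^sub>F n in sequentially. real (m n) / real n - real a * (1 / real n) = real (r n) / real n"
        using ev_a by eventually_elim (simp add: r_def of_nat_diff diff_divide_distrib)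
    qed
  qed
  have ev_D: "\<forall>\<^sub>F n in sequentially. 0 < D n"
  proof -
    have "\<forall>\<^sub>F n in sequentially. 0 < D n / real n"
      by (rule order_tendstoD(1)[OF Dn]) (use k in simp)
    then show ?thesis
      using eventually_gt_at_top[of 0] by eventually_elim (simp add: zero_less_divide_iff)
  qed
  have ev_Nm: "\<forall>\<^sub>F n in sequentially. 0 < real (N n) - real (m n)"
  proof -
    have "\<forall>\<^sub>F n in sequentially. 0 < (real (N n) - real (m n)) / real n ^ 2"
      by (rule order_tendstoD(1)[OF Nm2]) simp
    then show ?thesis
      using eventually_gt_at_top[of 0] by eventually_elim (simp add: zero_less_divide_iff)
  qed
  have ev_M: "\<forall>\<^sub>F n in sequentially. 0 < real (M n) - real (r n)"
  proof -
    have D2: "(\<lambda>n. D n / real n ^ 2) \<longlonglongrightarrow> 0"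
      by (rule linear_over_square[OF Dn])
    have "(\<lambda>n. (real (N n) - real (m n)) / real n ^ 2 - D n / real n ^ 2) \<longlonglongrightarrow> 1 / 2 - 0"
      by (intro tendsto_diff Nm2 D2)
    then have "\<forall>\<^sub>F n in sequentially. 0 < (real (N n) - real (m n)) / real n ^ 2 - D n / real n ^ 2"
      by (rule order_tendstoD) simp
    then show ?thesis
      using ev_a eventually_gt_at_top[of 0]
    proof eventually_elim
      case (elim n)
      then have "0 < (real (N n) - real (m n) - D n) / real n ^ 2"
        by (simp only: diff_divide_distrib)
      then have "D n < real (N n) - real (m n)"
        using elim(3) by (simp add: zero_less_divide_iff)
      then show ?case
        using elim by (simp add: D_def r_def of_nat_diff)
    qed
  qed
  \<comment> \<open>Both sides of the squeeze below have this shape, with \<open>Z = N - m\<close>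
    for the lower and \<open>Z = N - a\<close> for the upper bound; both are asymptotic to
    \<open>n\<^sup>2 / 2\<close>.\<close>
  have *: "(\<lambda>n. (1 - D n / (Z n)) ^ r n) \<longlonglongrightarrow> exp (- (c * real k))"
    if Z: "(\<lambda>n. Z n / real n ^ 2) \<longlonglongrightarrow> 1 / 2" for Z
  proof (rule tendsto_one_minus_power)
    have DZ: "(\<lambda>n. real n * (D n / Z n)) \<longlonglongrightarrow> real k / (1 / 2)"
    proof (rule Lim_transform_eventually)
      show "(\<lambda>n. (D n / real n) / (Z n / real n ^ 2)) \<longlonglongrightarrow> real k / (1 / 2)"
        by (intro tendsto_divide Dn Z) simp
      show "\<forall>\<^sub>F n in sequentially. (D n / real n) / (Z n / real n ^ 2) = real n * (D n / Z n)"
        using eventually_gt_at_top[of 0]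
        by eventually_elim (simp add: power2_eq_square)
    qed
    have "(\<lambda>n. real n * (D n / Z n) * (1 / real n)) \<longlonglongrightarrow> real k / (1 / 2) * 0"
      by (intro tendsto_mult DZ lim_1_over_n)
    then have "(\<lambda>n. real n * (D n / Z n) * (1 / real n)) \<longlonglongrightarrow> 0"
      by simp
    then show "(\<lambda>n. D n / Z n) \<longlonglongrightarrow> 0"
    proof (rule Lim_transform_eventually)
      show "\<forall>\<^sub>F n in sequentially. real n * (D n / Z n) * (1 / real n) = D n / Z n"
        using eventually_gt_at_top[of 0] by eventually_elim simp
    qed
    have "(\<lambda>n. real (r n) / real n * (real n * (D n / Z n))) \<longlonglongrightarrow> c / 2 * (real k / (1 / 2))"
      by (intro tendsto_mult DZ rn)
    then have "(\<lambda>n. real (r n) / real n * (real n * (D n / Z n))) \<longlonglongrightarrow> c * real k"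
      by simp
    then show "(\<lambda>n. real (r n) * (D n / Z n)) \<longlonglongrightarrow> c * real k"
    proof (rule Lim_transform_eventually)
      show "\<forall>\<^sub>F n in sequentially. real (r n) / real n * (real n * (D n / Z n)) = real (r n) * (D n / Z n)"
        using eventually_gt_at_top[of 0] by eventually_elim simp
    qed
    have "\<forall>\<^sub>F n in sequentially. 0 < Z n / real n ^ 2"
      using Z by (rule order_tendstoD) simp
    then show "\<forall>\<^sub>F n in sequentially. 0 \<le> D n / Z n"
      using ev_D by eventually_elim (auto simp: zero_less_divide_iff)
  qed
  have bin: "(\<lambda>n. real (M n choose r n) / real ((N n - a) choose r n)) \<longlonglongrightarrow> exp (- (c * real k))"
  proof (rule tendsto_sandwich)
    show "(\<lambda>n. (1 - D n / (real (N n) - real (m n))) ^ r n) \<longlonglongrightarrow> exp (- (c * real k))"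
      by (rule *[OF Nm2])
    show "(\<lambda>n. (1 - D n / (real (N n) - real a)) ^ r n) \<longlonglongrightarrow> exp (- (c * real k))"
      by (rule *[OF Na2])
    show "\<forall>\<^sub>F n in sequentially. (1 - D n / (real (N n) - real (m n))) ^ r n
        \<le> real (M n choose r n) / real ((N n - a) choose r n)"
      using ev_D ev_Nm ev_M ev_a ev_m
    proof eventually_elim
      case (elim n)
      have Na: "real (N n - a) = real (N n) - real a" and rr: "real (r n) = real (m n) - real a"
        using elim by (auto simp: r_def of_nat_diff)
      have "((real (M n) - real (r n)) / (real (N n - a) - real (r n))) ^ r n * real ((N n - a) choose r n)
          \<le> real (M n choose r n)"
      proof (rule binomial_ge_power_ratio)
        show "r n \<le> M n" using elim by simp
        have "real (M n) \<le> real (N n - a)"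
          using elim(1) unfolding Na D_def by linarith
        then show "M n \<le> N n - a" by simp
        have "real (r n) < real (N n - a)"
          using elim(2) unfolding Na rr by linarith
        then show "r n < N n - a" by simp
      qed
      moreover have "(real (M n) - real (r n)) / (real (N n - a) - real (r n)) =
          1 - D n / (real (N n) - real (m n))"
        unfolding Na rr D_def using elim(2) by (simp add: field_simps)
      moreover have "0 < (N n - a) choose r n"
        using elim by (intro zero_less_binomial) (auto simp: r_def)
      ultimately show ?case
        by (simp add: field_simps)
    qed
    show "\<forall>\<^sub>F n in sequentially. real (M n choose r n) / real ((N n - a) choose r n) \<le>
        (1 - D n / (real (N n) - real a)) ^ r n"
      using ev_D ev_Nm ev_a ev_m
    proof eventually_elim
      case (elim n)
      have Na: "real (N n - a) = real (N n) - real a"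
        using elim by (auto simp: of_nat_diff)
      have "real (M n) \<le> real (N n - a)"
        using elim(1) unfolding Na D_def by linarith
      then have "real (M n choose r n) \<le> (real (M n) / real (N n - a)) ^ r n * real ((N n - a) choose r n)"
        by (intro binomial_le_power_ratio) simp
      moreover have "real (M n) / real (N n - a) = 1 - D n / (real (N n) - real a)"
        unfolding Na D_def using elim by (simp add: field_simps)
      moreover have "0 < (N n - a) choose r n"
        using elim by (intro zero_less_binomial) (auto simp: r_def)
      ultimately show ?case
        by (simp add: field_simps)
    qed
  qed
  have pr: "(\<lambda>n. \<Prod>i<a. real n * ((real (m n) - real i) / (real (N n) - real i))) \<longlonglongrightarrow> (\<Prod>i<a. c)"
  proof (rule tendsto_prod)
    fix i assume "i \<in> {..<a}"
    have "(\<lambda>n. (real (m n) / real n - real i * (1 / real n)) / (real (N n) / real n ^ 2 - real i / real n ^ 2))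
        \<longlonglongrightarrow> (c / 2 - 0) / (1 / 2 - 0)"
      by (intro tendsto_divide tendsto_diff m inv inv2 N2) simp
    then have "(\<lambda>n. (real (m n) / real n - real i * (1 / real n)) / (real (N n) / real n ^ 2 - real i / real n ^ 2))
        \<longlonglongrightarrow> c" by simp
    then show "(\<lambda>n. real n * ((real (m n) - real i) / (real (N n) - real i))) \<longlonglongrightarrow> c"
    proof (rule Lim_transform_eventually)
      show "\<forall>\<^sub>F n in sequentially. (real (m n) / real n - real i * (1 / real n)) /
            (real (N n) / real n ^ 2 - real i / real n ^ 2) =
          real n * ((real (m n) - real i) / (real (N n) - real i))"
        using eventually_gt_at_top[of 0]
        by eventually_elim (simp add: diff_divide_distrib[symmetric] power2_eq_square)
    qed
  qed
  have "(\<lambda>n. (\<Prod>i<a. real n * ((real (m n) - real i) / (real (N n) - real i))) *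
      (real (M n choose r n) / real ((N n - a) choose r n))) \<longlonglongrightarrow> c ^ a * exp (- (c * real k))"
    using tendsto_mult[OF pr bin] by simp
  then have "(\<lambda>n. real n ^ a * tree_prob b k n (m n)) \<longlonglongrightarrow> c ^ a * exp (- (c * real k))"
  proof (rule Lim_transform_eventually)
    show "\<forall>\<^sub>F n in sequentially. (\<Prod>i<a. real n * ((real (m n) - real i) / (real (N n) - real i))) *
      (real (M n choose r n) / real ((N n - a) choose r n)) = real n ^ a * tree_prob b k n (m n)"
      using ev_a ev_m
    proof eventually_elim
      case (elim n)
      define P Q where "P = (\<Prod>i<a. real (m n) - real i)" and "Q = (\<Prod>i<a. real (N n) - real i)"
      have eq: "real (N n choose m n) * P = Q * real ((N n - a) choose r n)"
        unfolding P_def Q_def r_def by (rule binomial_absorption_prod[OF elim])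
      have pos: "Q > 0" "0 < real ((N n - a) choose r n)" "0 < real (N n choose m n)"
        unfolding Q_def using elim by (auto intro!: prod_pos simp: r_def)
      have "(\<Prod>i<a. real n * ((real (m n) - real i) / (real (N n) - real i))) = real n ^ a * (P / Q)"
        by (simp add: prod.distrib prod_dividef P_def Q_def)
      moreover have "P / Q * (real (M n choose r n) / real ((N n - a) choose r n)) = tree_prob b k n (m n)"
      proof -
        have "P / Q / real ((N n - a) choose r n) = 1 / real (N n choose m n)"
          using eq pos by (simp add: field_simps)
        moreover have "tree_prob b k n (m n) = real (M n choose r n) * (1 / real (N n choose m n))"
          by (simp add: tree_prob_def a_def N_def M_def r_def)
        ultimately show ?thesis
          by (metis (no_types, lifting) mult.commute times_divide_eq_left times_divide_eq_right)
      qed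
      ultimately show ?case
        by (simp only: mult.assoc)
    qed
  qed
  then show ?thesis by (simp add: a_def)
qed

text \<open>Densities \<open>c\<^sub>1\<close> and \<open>c\<^sub>2\<close> with the same value of \<open>c e\<^sup>-\<^sup>c\<close> have tree components of every
  fixed size in the same ratio \<open>c\<^sub>2 : c\<^sub>1\<close>, so the number of trees never has to be known.\<close>

lemma mean_comps_compare:
  assumes m1: "(\<lambda>n. real (m1 n) / real n) \<longlonglongrightarrow> c1 / 2" and c1: "0 < c1"
    and m2: "(\<lambda>n. real (m2 n) / real n) \<longlonglongrightarrow> c2 / 2" and c2: "0 < c2"
    and dual: "c1 * exp (- c1) = c2 * exp (- c2)"
    and \<eta>: "0 < \<eta>"
  shows "\<forall>\<^sub>F n in sequentially. mean n (m1 n) (n_comps n) \<le>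
     c2 / c1 * mean n (m2 n) (n_comps n) + \<eta> * real n"
proof -
  \<comment> \<open>Half of \<eta> pays for the components larger than \<open>K\<close>; the other
    half pays for the error in the ratios, using that there are at most \<open>n\<close>
    components.\<close>
  obtain K :: nat where K: "0 < K" "1 / real K < \<eta> / 2"
    using real_arch_inverse[of "\<eta> / 2"] \<eta> by (auto simp: inverse_eq_divide)
  \<comment> \<open>The overcount (inner edges allowed) at \<open>m1\<close> is set against the
    undercount (isolated trees) at \<open>m2\<close>. This loses nothing in the limit, which does
    not depend on \<open>b\<close>.\<close>
  have ratio: "\<forall>\<^sub>F n in sequentially. tree_prob ((k choose 2) - (k - 1)) k n (m1 n) \<le>
      (c2 / c1 + \<eta> / 2) * tree_prob 0 k n (m2 n)" if k: "k \<in> {1..K}" for k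
  proof -
    have k1: "1 \<le> k" using k by simp
    let ?b = "(k choose 2) - (k - 1)"
    define L where "L = c2 ^ (k - 1) * exp (- (c2 * real k))"
    \<comment> \<open>In this form the limit depends on the density only through
      \<open>c * exp (- c)\<close>, apart from the factor \<open>1 / c\<close>; duality makes the
      powers agree for every \<open>k\<close> at once.\<close>
    have pw: "c ^ (k - 1) * exp (- (c * real k)) = (c * exp (- c)) ^ k / c" if "0 < c" for c :: real
    proof -
      have "c ^ k = c * c ^ (k - 1)"
        using k1 by (cases k) auto
      moreover have "exp (- (c * real k)) = exp (- c) ^ k"
        by (simp add: exp_of_nat_mult[symmetric] mult.commute)
      ultimately show ?thesis
        using that by (simp add: power_mult_distrib)
    qed
    have "c1 ^ (k - 1) * exp (- (c1 * real k)) = c2 / c1 * L"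
      unfolding L_def pw[OF c1] pw[OF c2] dual using c2 by simp
    then have 1: "(\<lambda>n. real n ^ (k - 1) * tree_prob ?b k n (m1 n)) \<longlonglongrightarrow> c2 / c1 * L"
      using tree_prob_limit[OF m1 c1 k1, of ?b] by simp
    have 2: "(\<lambda>n. real n ^ (k - 1) * tree_prob 0 k n (m2 n)) \<longlonglongrightarrow> L"
      using tree_prob_limit[OF m2 c2 k1, of 0] by (simp add: L_def)
    have "L > 0"
      using c2 by (simp add: L_def)
    have "(\<lambda>n. (c2 / c1 + \<eta> / 2) * (real n ^ (k - 1) * tree_prob 0 k n (m2 n)) -
        real n ^ (k - 1) * tree_prob ?b k n (m1 n)) \<longlonglongrightarrow> (c2 / c1 + \<eta> / 2) * L - c2 / c1 * L"
      by (intro tendsto_intros 1 2)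
    then have "\<forall>\<^sub>F n in sequentially. 0 < (c2 / c1 + \<eta> / 2) * (real n ^ (k - 1) * tree_prob 0 k n (m2 n)) -
        real n ^ (k - 1) * tree_prob ?b k n (m1 n)"
      by (rule order_tendstoD) (use \<eta> \<open>L > 0\<close> in \<open>simp add: algebra_simps\<close>)
    then show ?thesis
      using eventually_gt_at_top[of 0]
    proof eventually_elim
      case (elim n)
      then have "real n ^ (k - 1) * tree_prob ?b k n (m1 n) \<le>
          real n ^ (k - 1) * ((c2 / c1 + \<eta> / 2) * tree_prob 0 k n (m2 n))"
        by (simp add: algebra_simps)
      then show ?case
        by (rule mult_left_le_imp_le) (use elim in simp)
    qed
  qed
  then have "\<forall>\<^sub>F n in sequentially. \<forall>k\<in>{1..K}. tree_prob ((k choose 2) - (k - 1)) k n (m1 n) \<le>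
      (c2 / c1 + \<eta> / 2) * tree_prob 0 k n (m2 n)"
    by (intro eventually_ball_finite) auto
  moreover have "\<forall>\<^sub>F n in sequentially. m1 n \<le> n choose 2" "\<forall>\<^sub>F n in sequentially. m2 n \<le> n choose 2"
    using m1 m2 by (auto intro: eventually_le_choose_2)
  moreover have "\<forall>\<^sub>F n in sequentially. K \<le> m1 n" "\<forall>\<^sub>F n in sequentially. K \<le> m2 n"
    using eventually_ge_const[OF m1] eventually_ge_const[OF m2] c1 c2 by simp_all
  ultimately show ?thesis
  proof eventually_elim
    case (elim n)
    have "mean n (m1 n) (n_comps n) \<le>
        (\<Sum>k\<in>{1..K}. n_trees k n * tree_prob ((k choose 2) - (k - 1)) k n (m1 n)) + real n / real K"
      using elim K by (intro mean_comps_le_trees) auto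
    also have "\<dots> \<le> (\<Sum>k\<in>{1..K}. n_trees k n * ((c2 / c1 + \<eta> / 2) * tree_prob 0 k n (m2 n))) + real n / real K"
      using elim by (intro add_right_mono sum_mono mult_left_mono) (auto simp: n_trees_def)
    also have "\<dots> = (c2 / c1 + \<eta> / 2) * (\<Sum>k\<in>{1..K}. n_trees k n * tree_prob 0 k n (m2 n)) + real n / real K"
      by (simp add: sum_distrib_left mult_ac)
    also have "\<dots> \<le> (c2 / c1 + \<eta> / 2) * mean n (m2 n) (n_comps n) + real n / real K"
      using elim c1 c2 \<eta> by (intro add_right_mono mult_left_mono mean_comps_ge_trees) auto
    also have "\<dots> = c2 / c1 * mean n (m2 n) (n_comps n) + (\<eta> / 2 * mean n (m2 n) (n_comps n) + real n * (1 / real K))"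
      by (simp add: algebra_simps)
    also have "\<eta> / 2 * mean n (m2 n) (n_comps n) + real n * (1 / real K) \<le> \<eta> / 2 * real n + real n * (\<eta> / 2)"
      using elim \<eta> K by (intro add_mono mult_left_mono mean_comps_le) auto
    finally show ?case by (simp add: algebra_simps)
  qed
qed

text \<open>Since \<open>q\<close> tends to \<open>c < 1\<close>, the cycle term
  \<open>1 / (1 - q)\<close> stays bounded and vanishes after division by \<open>n\<close>.\<close>

lemma mean_comps_subcritical:
  assumes m: "(\<lambda>n. real (m n) / real n) \<longlonglongrightarrow> c / 2" and c: "0 < c" "c < 1" and \<eta>: "0 < \<eta>"
  shows "\<forall>\<^sub>F n in sequentially. mean n (m n) (n_comps n) \<le> (1 - c / 2 + \<eta>) * real n"
proof -
  define q where "q = (\<lambda>n. real n * real (m n) / real (n choose 2))"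
  have "q \<longlonglongrightarrow> (c / 2) / (1 / 2)"
  proof (rule Lim_transform_eventually)
    show "(\<lambda>n. (real (m n) / real n) / (real (n choose 2) / real n ^ 2)) \<longlonglongrightarrow> (c / 2) / (1 / 2)"
      by (intro tendsto_divide m choose_2_ratio) simp
    show "\<forall>\<^sub>F n in sequentially. (real (m n) / real n) / (real (n choose 2) / real n ^ 2) = q n"
      using eventually_gt_at_top[of 0]
      by eventually_elim (simp add: q_def power2_eq_square)
  qed
  then have q: "q \<longlonglongrightarrow> c" by simp
  have "(\<lambda>n. 1 - real (m n) / real n + 1 / (1 - q n) * (1 / real n)) \<longlonglongrightarrow> 1 - c / 2 + 1 / (1 - c) * 0"
    by (intro tendsto_intros m q lim_1_over_n) (use c in auto)
  then have "\<forall>\<^sub>F n in sequentially. 1 - real (m n) / real n + 1 / (1 - q n) * (1 / real n) < 1 - c / 2 + \<eta>"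
    by (rule order_tendstoD) (use \<eta> in simp)
  moreover have "\<forall>\<^sub>F n in sequentially. q n < 1"
    using q c(2) by (rule order_tendstoD)
  moreover have "\<forall>\<^sub>F n in sequentially. m n \<le> n choose 2"
    using m by (rule eventually_le_choose_2)
  ultimately show ?thesis
    using eventually_gt_at_top[of 0]
  proof eventually_elim
    case (elim n)
    have "mean n (m n) (n_comps n) \<le> real n - real (m n) + 1 / (1 - q n)"
      using elim by (intro mean_comps_le_subcritical) (auto simp: q_def)
    also have "\<dots> = (1 - real (m n) / real n + 1 / (1 - q n) * (1 / real n)) * real n"
      using elim by (simp add: field_simps)
    also have "\<dots> \<le> (1 - c / 2 + \<eta>) * real n"
      using elim by (intro mult_right_mono) auto
    finally show ?case .
  qed
qed

section \<open>The limiting cyclomatic number\<close>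

text \<open>With \<open>c x = - ln (1 - x)\<close> this is
  \<open>(c / 2) (1 - (1 - x)\<^sup>2) - x\<close>. If \<open>x\<close> is the fraction of vertices
  in the giant component at average degree \<open>c\<close>, that is its edges minus its vertices,
  per vertex of the graph.\<close>

definition excess :: "real \<Rightarrow> real" where
  "excess x = - ln (1 - x) - x + x / 2 * ln (1 - x)"

text \<open>The right side has the power series with terms \<open>(1 - 1 / k) x ^ k\<close>, of
  which \<open>x\<^sup>2 / 2\<close> is the first nonzero one. It is twice the derivative of
  \<open>excess\<close>.\<close>

lemma ln_one_minus_lower:
  assumes "0 \<le> x" "x < (1::real)"
  shows "x\<^sup>2 / 2 \<le> x / (1 - x) + ln (1 - x)"
proof -
  define f where "f = (\<lambda>x::real. x / (1 - x) + ln (1 - x) - x\<^sup>2 / 2)"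
  have "f 0 \<le> f x"
  proof (rule DERIV_nonneg_imp_nondecreasing[OF assms(1)])
    fix y assume y: "0 \<le> y" "y \<le> x"
    then have y1: "y < 1" using assms by simp
    have "(f has_real_derivative (1 * (1 - y) - y * (0 - 1)) / ((1 - y) * (1 - y)) + 1 / (1 - y) * (0 - 1) - y) (at y)"
      unfolding f_def using y1 by (auto intro!: derivative_eq_intros)
    moreover have "(1 * (1 - y) - y * (0 - 1)) / ((1 - y) * (1 - y)) + 1 / (1 - y) * (0 - 1) - y =
        y * (1 / (1 - y)\<^sup>2 - 1)"
    proof -
      have "(1 * u - (1 - u) * (0 - 1)) / (u * u) + 1 / u * (0 - 1) - (1 - u) = (1 - u) * (1 / u\<^sup>2 - 1)"
        if "u \<noteq> 0" for u :: real
        using that by (simp add: field_simps power2_eq_square)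
      from this[of "1 - y"] show ?thesis
        using y1 by simp
    qed
    moreover have "0 \<le> y * (1 / (1 - y)\<^sup>2 - 1)"
    proof (rule mult_nonneg_nonneg)
      have "(1 - y)\<^sup>2 \<le> 1"
        using y y1 by (intro power_le_one) auto
      then show "0 \<le> 1 / (1 - y)\<^sup>2 - 1"
        using y1 by simp
    qed (rule y(1))
    ultimately show "\<exists>d. (f has_real_derivative d) (at y) \<and> 0 \<le> d"
      by metis
  qed
  then show ?thesis by (simp add: f_def)
qed

text \<open>The first two terms of the logarithmic series; for \<open>c = - ln (1 - x) / x\<close>
  it says \<open>x \<le> 2 (c - 1)\<close>.\<close>

lemma ln_one_minus_upper:
  assumes "0 \<le> x" "x < (1::real)"
  shows "x + x\<^sup>2 / 2 \<le> - ln (1 - x)"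
proof -
  define f where "f = (\<lambda>x::real. - ln (1 - x) - x - x\<^sup>2 / 2)"
  have "f 0 \<le> f x"
  proof (rule DERIV_nonneg_imp_nondecreasing[OF assms(1)])
    fix y assume y: "0 \<le> y" "y \<le> x"
    then have y1: "y < 1" using assms by simp
    have "(f has_real_derivative 1 / (1 - y) - 1 - y) (at y)"
      unfolding f_def using y1 by (auto intro!: derivative_eq_intros)
    moreover have "0 \<le> 1 / (1 - y) - 1 - y"
      using y y1 by (simp add: field_simps)
    ultimately show "\<exists>d. (f has_real_derivative d) (at y) \<and> 0 \<le> d"
      by metis
  qed
  then show ?thesis by (simp add: f_def)
qed

lemma excess_deriv:
  assumes "y < 1"
  shows "(excess has_real_derivative (y / (1 - y) + ln (1 - y)) / 2) (at y)"
proof -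
  have "(excess has_real_derivative 1 / (1 - y) - 1 + (1 / 2 * ln (1 - y) + y / 2 * (- 1 / (1 - y)))) (at y)"
    unfolding excess_def [abs_def] using assms by (auto intro!: derivative_eq_intros simp: divide_simps) (simp add: algebra_simps)
  moreover have "1 / (1 - y) - 1 + (1 / 2 * ln (1 - y) + y / 2 * (- 1 / (1 - y))) =
      (y / (1 - y) + ln (1 - y)) / 2"
  proof -
    have "1 / u - 1 + (1 / 2 * L + (1 - u) / 2 * (- 1 / u)) = ((1 - u) / u + L) / 2" if "u \<noteq> 0" for u L :: real
      using that by (simp add: field_simps)
    moreover have "1 - (1 - y) = y" "1 - y \<noteq> 0"
      using assms by auto
    ultimately show ?thesis by metis
  qed
  ultimately show ?thesis by (simp only:)
qed

text \<open>The derivative of \<open>excess\<close> is at least \<open>y\<^sup>2 / 4\<close>;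
  integration from 0 gives the 12.\<close>

lemma excess_lower:
  assumes "0 \<le> x" "x < 1"
  shows "x ^ 3 / 12 \<le> excess x"
proof -
  define f where "f = (\<lambda>x. excess x - x ^ 3 / 12)"
  have "f 0 \<le> f x"
  proof (rule DERIV_nonneg_imp_nondecreasing[OF assms(1)])
    fix y assume y: "0 \<le> y" "y \<le> x"
    then have y1: "y < 1" using assms by simp
    have "(f has_real_derivative (y / (1 - y) + ln (1 - y)) / 2 - y\<^sup>2 / 4) (at y)"
      unfolding f_def by (auto intro!: derivative_eq_intros excess_deriv[OF y1])
    moreover have "0 \<le> (y / (1 - y) + ln (1 - y)) / 2 - y\<^sup>2 / 4"
      using ln_one_minus_lower[OF y(1) y1] by simp
    ultimately show "\<exists>d. (f has_real_derivative d) (at y) \<and> 0 \<le> d"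
      by metis
  qed
  then show ?thesis by (simp add: f_def excess_def)
qed

text \<open>With \<open>c = - ln (1 - x) / x\<close> the excess satisfies \<open>d excess / d c = x\<^sup>2 / 2\<close>, and
  \<open>x \<le> 2 (c - 1)\<close>; integrating gives the constant \<open>2/3\<close>.\<close>

lemma excess_upper:
  assumes x: "0 < x" "x < 1"
  shows "excess x \<le> 2 / 3 * (- ln (1 - x) / x - 1) ^ 3"
proof -
  define \<delta> where "\<delta> = (\<lambda>x::real. - ln (1 - x) / x - 1)"
  define f where "f = (\<lambda>x. 2 / 3 * \<delta> x ^ 3 - excess x)"
  have \<delta>: "y / 2 \<le> \<delta> y" if "0 < y" "y < 1" for y
    using ln_one_minus_upper[of y] that by (simp add: \<delta>_def field_simps power2_eq_square)
  have mono: "f s \<le> f x" if s: "0 < s" "s \<le> x" for s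
  proof (rule DERIV_nonneg_imp_nondecreasing[OF s(2)])
    fix y assume y: "s \<le> y" "y \<le> x"
    then have y1: "0 < y" "y < 1" using x s by auto
    define B where "B = y / (1 - y) + ln (1 - y)"
    have B: "0 \<le> B"
      using ln_one_minus_lower[of y] y1 unfolding B_def
      by (metis less_eq_real_def order_trans zero_le_power2 divide_nonneg_pos zero_less_numeral)
    have "(\<delta> has_real_derivative B / y\<^sup>2) (at y)"
      unfolding \<delta>_def B_def using y1
      by (auto intro!: derivative_eq_intros simp: field_simps power2_eq_square)
    then have "(f has_real_derivative 2 / 3 * (3 * \<delta> y ^ 2 * (B / y\<^sup>2)) - B / 2) (at y)"
      unfolding f_def B_def
      by (auto intro!: derivative_eq_intros excess_deriv[OF y1(2)])
    moreover have "0 \<le> 2 / 3 * (3 * \<delta> y ^ 2 * (B / y\<^sup>2)) - B / 2"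
    proof -
      have "(y / 2)\<^sup>2 \<le> \<delta> y ^ 2"
        using \<delta>[OF y1] y1 by (intro power_mono) auto
      then have "1 / 4 \<le> \<delta> y ^ 2 / y\<^sup>2"
        using y1 by (simp add: field_simps power2_eq_square)
      then have "B * (1 / 2) \<le> B * (2 * (\<delta> y ^ 2 / y\<^sup>2))"
        using B by (intro mult_left_mono) linarith+
      then show ?thesis by simp
    qed
    ultimately show "\<exists>d. (f has_real_derivative d) (at y) \<and> 0 \<le> d"
      by metis
  qed
  \<comment> \<open>At 0 the quotient in \<delta> is a division by zero, so \<open>f 0\<close> is
    not the limit of \<open>f\<close>. Monotonicity is used from a small \<open>s > 0\<close>
    instead, where \<open>- excess s \<le> f s \<le> f x\<close>, and then \<open>s\<close> tends to
    0.\<close>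
  have "isCont excess 0"
    using excess_deriv[of 0] by (intro DERIV_isCont) auto
  then have "(excess \<longlongrightarrow> excess 0) (at_right 0)"
    unfolding isCont_def by (rule tendsto_mono[OF at_le, rotated]) simp
  then have "((\<lambda>s. - excess s) \<longlongrightarrow> - excess 0) (at_right 0)"
    by (rule tendsto_minus)
  then have "((\<lambda>s. - excess s) \<longlongrightarrow> 0) (at_right 0)"
    by (simp add: excess_def)
  moreover have "\<forall>\<^sub>F s in at_right 0. - excess s \<le> f x"
    using eventually_at_right_less[of 0] eventually_at_right_real[OF x(1)]
  proof eventually_elim
    case (elim s)
    then have s: "0 < s" "s \<le> x" "s < 1" using x by auto
    have "0 \<le> \<delta> s"
      using \<delta>[of s] s by auto
    then have "- excess s \<le> f s"
      by (simp add: f_def)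
    then show ?case
      using mono[OF s(1,2)] by simp
  qed
  ultimately have "0 \<le> f x"
    by (rule tendsto_upperbound) simp
  then show ?thesis by (simp add: f_def \<delta>_def)
qed

section \<open>The dual density and the number of components above the threshold\<close>

text \<open>\<open>x\<close> is the positive root of \<open>1 - x = exp (- c x)\<close>, and the
  dual density is \<open>c (1 - x)\<close>. The lower bound \<open>1 - 1 / c\<close> keeps the root
  away from the trivial one at 0 and later compares it with \<epsilon>.\<close>

lemma dual_density:
  assumes c: "1 < (c::real)"
  obtains x where "1 - 1 / c \<le> x" "0 < x" "x < 1" "- ln (1 - x) = c * x" "c * (1 - x) < 1"
proof -
  define f where "f = (\<lambda>x. - ln (1 - x) - c * x)"
  \<comment> \<open>At the left end the sign is \<open>ln c \<le> c - 1\<close>; at the right end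
    \<open>- ln (1 - x)\<close> equals \<open>c\<close>, which exceeds \<open>c x\<close>.\<close>
  have "\<exists>x\<ge>1 - 1 / c. x \<le> 1 - exp (- c) \<and> f x = 0"
  proof (rule IVT')
    have "ln c \<le> c - 1"
      using c by (intro ln_le_minus_one) simp
    moreover have "c * (1 - 1 / c) = c - 1"
      using c by (simp add: field_simps)
    ultimately show "f (1 - 1 / c) \<le> 0"
      using c by (simp add: f_def ln_div)
    show "0 \<le> f (1 - exp (- c))"
      using c by (simp add: f_def algebra_simps)
    have "c \<le> exp c"
      using exp_ge_add_one_self[of c] by linarith
    then show "1 - 1 / c \<le> 1 - exp (- c)"
      using c by (simp add: exp_minus field_simps)
    show "continuous_on {1 - 1 / c..1 - exp (- c)} f"
      unfolding f_def
    proof (intro continuous_intros)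
      show "\<forall>x\<in>{1 - 1 / c..1 - exp (- c)}. 1 - x \<noteq> 0"
        using exp_gt_zero[of "- c"] by fastforce
    qed
  qed
  then obtain x where x: "1 - 1 / c \<le> x" "x \<le> 1 - exp (- c)" "f x = 0"
    by blast
  have "0 < 1 - 1 / c"
    using c by simp
  then have x0: "0 < x" using x by simp
  have x1: "x < 1"
    using x(2) exp_gt_zero[of "- c"] by linarith
  have eq: "- ln (1 - x) = c * x"
    using x(3) by (simp add: f_def)
  \<comment> \<open>Strictness, available as \<open>1 / (1 - x)\<close> is not 1, is what puts the
    dual density strictly below the threshold.\<close>
  have "ln (1 / (1 - x)) < 1 / (1 - x) - 1"
  proof (rule le_neq_trans)
    show "ln (1 / (1 - x)) \<le> 1 / (1 - x) - 1"
      using x1 by (intro ln_le_minus_one) simp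
    show "ln (1 / (1 - x)) \<noteq> 1 / (1 - x) - 1"
      using ln_eq_minus_one[of "1 / (1 - x)"] x0 x1 by auto
  qed
  then have "c * x < x / (1 - x)"
    using x1 eq by (simp add: ln_div field_simps)
  then have "(c * (1 - x)) * x < 1 * x"
    using x1 by (simp add: pos_less_divide_eq mult_ac)
  then have "c * (1 - x) < 1"
    using x0 by (simp only: mult_less_cancel_right_pos)
  then show ?thesis
    using that x(1) x0 x1 eq by blast
qed

lemma floor_linear:
  assumes "0 \<le> a"
  shows "(\<lambda>n. real (nat \<lfloor>a * real n\<rfloor>) / real n) \<longlonglongrightarrow> a"
proof (rule tendsto_sandwich)
  have "(\<lambda>n. a - 1 / real n) \<longlonglongrightarrow> a - 0"
    by (intro tendsto_intros lim_1_over_n)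
  then show "(\<lambda>n. a - 1 / real n) \<longlonglongrightarrow> a" by simp
  show "(\<lambda>n. a) \<longlonglongrightarrow> a" by simp
  have nat: "real (nat \<lfloor>a * real n\<rfloor>) = of_int \<lfloor>a * real n\<rfloor>" for n
    using assms by simp
  show "\<forall>\<^sub>F n in sequentially. a - 1 / real n \<le> real (nat \<lfloor>a * real n\<rfloor>) / real n"
    using eventually_gt_at_top[of 0]
  proof eventually_elim
    case (elim n)
    have "(a * real n - 1) / real n \<le> of_int \<lfloor>a * real n\<rfloor> / real n"
      by (rule divide_right_mono) linarith+
    then show ?case
      unfolding nat using elim by (simp add: diff_divide_distrib)
  qed
  show "\<forall>\<^sub>F n in sequentially. real (nat \<lfloor>a * real n\<rfloor>) / real n \<le> a"
    using eventually_gt_at_top[of 0]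
  proof eventually_elim
    case (elim n)
    then show ?case
      unfolding nat by (simp add: divide_le_eq)
  qed
qed

text \<open>At the dual density the component count is pinned between \<open>n - m2\<close> and
  \<open>n - m2 + O(1)\<close>. Comparing in both directions, with factors \<open>d / c\<close> and
  \<open>c / d\<close>, transfers this to \<open>m\<close>. The value \<open>x\<close> is the
  limiting cyclomatic number per vertex.\<close>

lemma mean_comps_supercritical:
  assumes \<epsilon>: "0 < \<epsilon>" and m: "(\<lambda>n. real (m n) / real n) \<longlonglongrightarrow> 1 / 2 + \<epsilon>"
  obtains x where "x \<le> 16 / 3 * \<epsilon> ^ 3" "\<epsilon> \<le> 1 / 2 \<Longrightarrow> \<epsilon> ^ 3 / 12 \<le> x"
    "\<And>\<eta>. 0 < \<eta> \<Longrightarrow> \<forall>\<^sub>F n in sequentially. mean n (m n) (n_comps n) \<le> (1 / 2 - \<epsilon> + x + \<eta>) * real n"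
    "\<And>\<eta>. 0 < \<eta> \<Longrightarrow> \<forall>\<^sub>F n in sequentially. (1 / 2 - \<epsilon> + x - \<eta>) * real n \<le> mean n (m n) (n_comps n)"
proof -
  define c where "c = 1 + 2 * \<epsilon>"
  have c: "1 < c" using \<epsilon> by (simp add: c_def)
  obtain \<rho> where \<rho>: "1 - 1 / c \<le> \<rho>" "0 < \<rho>" "\<rho> < 1" "- ln (1 - \<rho>) = c * \<rho>" "c * (1 - \<rho>) < 1"
    using dual_density[OF c] by blast
  have ln\<rho>: "ln (1 - \<rho>) = - (c * \<rho>)"
    using \<rho>(4) by linarith
  define d where "d = c * (1 - \<rho>)"
  have d: "0 < d" "d < 1"
    using c \<rho> by (auto simp: d_def)
  have dc: "d / c = 1 - \<rho>"
    using c by (simp add: d_def)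
  have dual: "c * exp (- c) = d * exp (- d)"
  proof -
    have "1 - \<rho> = exp (ln (1 - \<rho>))"
      using \<rho> by simp
    also have "\<dots> = exp (- (c * \<rho>))"
      by (simp add: ln\<rho>)
    finally have "d * exp (- d) = c * (exp (- (c * \<rho>)) * exp (- d))"
      by (simp add: d_def)
    also have "exp (- (c * \<rho>)) * exp (- d) = exp (- c)"
      by (simp add: exp_add[symmetric] d_def algebra_simps)
    finally show ?thesis by simp
  qed
  define m2 where "m2 = (\<lambda>n::nat. nat \<lfloor>d / 2 * real n\<rfloor>)"
  have m2: "(\<lambda>n. real (m2 n) / real n) \<longlonglongrightarrow> d / 2"
    unfolding m2_def using d by (intro floor_linear) simp
  have mc: "(\<lambda>n. real (m n) / real n) \<longlonglongrightarrow> c / 2"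
    using m by (simp add: c_def add_divide_distrib)
  have ex: "excess \<rho> = c * \<rho> - \<rho> - c * \<rho>\<^sup>2 / 2"
    by (simp add: excess_def ln\<rho> power2_eq_square)
  \<comment> \<open>Both sides equal \<open>(1 - \<rho>) - c (1 - \<rho>)\<^sup>2 / 2\<close>,
    because \<open>1/2 - \<epsilon> = 1 - c / 2\<close>.\<close>
  have val: "d / c * (1 - d / 2) = 1 / 2 - \<epsilon> + excess \<rho>"
    unfolding dc ex by (simp add: d_def c_def field_simps power2_eq_square)
  show ?thesis
  proof (rule that[of "excess \<rho>"])
    have "- ln (1 - \<rho>) / \<rho> - 1 = 2 * \<epsilon>"
      using \<rho> by (simp add: c_def)
    then show "excess \<rho> \<le> 16 / 3 * \<epsilon> ^ 3"
      using excess_upper[OF \<rho>(2,3)] by (simp add: power_mult_distrib)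
    show "\<epsilon> ^ 3 / 12 \<le> excess \<rho>" if "\<epsilon> \<le> 1 / 2"
    proof -
      \<comment> \<open>\<open>1 - 1 / c = 2 \<epsilon> / (1 + 2 \<epsilon>)\<close>, which is at
        least \<epsilon> exactly when \<epsilon> \<le> 1/2.\<close>
      have "\<epsilon> \<le> 1 - 1 / c"
        using that \<epsilon> by (simp add: c_def field_simps mult_left_le)
      then have "\<epsilon> ^ 3 \<le> \<rho> ^ 3"
        using \<epsilon> \<rho>(1) by (intro power_mono) auto
      then show ?thesis
        using excess_lower[of \<rho>] \<rho> by simp
    qed
    fix \<eta> :: real assume \<eta>: "0 < \<eta>"
    have "\<forall>\<^sub>F n in sequentially. mean n (m n) (n_comps n) \<le> d / c * mean n (m2 n) (n_comps n) + \<eta> / 2 * real n"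
      using c d \<eta> by (intro mean_comps_compare[OF mc _ m2 _ dual]) auto
    moreover have "\<forall>\<^sub>F n in sequentially. mean n (m2 n) (n_comps n) \<le> (1 - d / 2 + \<eta> / 2) * real n"
      using d \<eta> by (intro mean_comps_subcritical[OF m2]) auto
    ultimately show "\<forall>\<^sub>F n in sequentially. mean n (m n) (n_comps n) \<le> (1 / 2 - \<epsilon> + excess \<rho> + \<eta>) * real n"
    proof eventually_elim
      case (elim n)
      have "mean n (m n) (n_comps n) \<le> d / c * ((1 - d / 2 + \<eta> / 2) * real n) + \<eta> / 2 * real n"
        using elim(1) mult_left_mono[OF elim(2), of "d / c"] c d by (simp add: field_simps)
      also have "\<dots> = (d / c * (1 - d / 2) + d / c * (\<eta> / 2) + \<eta> / 2) * real n"
        by (simp add: algebra_simps)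
      also have "\<dots> \<le> (1 / 2 - \<epsilon> + excess \<rho> + \<eta>) * real n"
      proof (rule mult_right_mono)
        have "d / c * (\<eta> / 2) \<le> 1 * (\<eta> / 2)"
          unfolding dc using \<rho> \<eta> by (intro mult_right_mono) auto
        then show "d / c * (1 - d / 2) + d / c * (\<eta> / 2) + \<eta> / 2 \<le> 1 / 2 - \<epsilon> + excess \<rho> + \<eta>"
          unfolding val by linarith
      qed simp
      finally show ?case .
    qed
    have "\<forall>\<^sub>F n in sequentially. mean n (m2 n) (n_comps n) \<le> c / d * mean n (m n) (n_comps n) + \<eta> * real n"
      using c d \<eta> by (intro mean_comps_compare[OF m2 _ mc _ dual[symmetric]]) auto
    moreover have "\<forall>\<^sub>F n in sequentially. m2 n \<le> n choose 2"
      by (rule eventually_le_choose_2[OF m2])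
    ultimately show "\<forall>\<^sub>F n in sequentially. (1 / 2 - \<epsilon> + excess \<rho> - \<eta>) * real n \<le> mean n (m n) (n_comps n)"
    proof eventually_elim
      case (elim n)
      have "real (m2 n) \<le> d / 2 * real n"
        unfolding m2_def using d by (intro of_nat_floor) simp
      then have "(1 - d / 2) * real n \<le> c / d * mean n (m n) (n_comps n) + \<eta> * real n"
        using elim(1) mean_comps_ge[OF elim(2)] by (simp add: algebra_simps)
      then have "d / c * ((1 - d / 2) * real n) \<le> d / c * (c / d * mean n (m n) (n_comps n) + \<eta> * real n)"
        using c d by (intro mult_left_mono) auto
      also have "\<dots> = mean n (m n) (n_comps n) + d / c * (\<eta> * real n)"
        using c d by (simp add: field_simps)
      also have "\<dots> \<le> mean n (m n) (n_comps n) + 1 * (\<eta> * real n)"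
        unfolding dc using \<rho> \<eta> by (intro add_left_mono mult_right_mono) auto
      finally show ?case
        unfolding mult.assoc[symmetric] val by (simp add: algebra_simps)
    qed
  qed
qed

section \<open>Weighted counting of cuts\<close>

text \<open>The elementary symmetric polynomial against the multinomial expansion: every
  \<open>m\<close>-subset occurs there in \<open>m!\<close> orders, and the other terms are
  nonnegative. It replaces distinct edges by independent draws.\<close>

lemma sum_prod_subsets_le:
  fixes w :: "'a \<Rightarrow> real"
  assumes "finite U" "\<And>e. e \<in> U \<Longrightarrow> 0 \<le> w e"
  shows "fact m * (\<Sum>E\<in>{E. E \<subseteq> U \<and> card E = m}. \<Prod>e\<in>E. w e) \<le> (\<Sum>e\<in>U. w e) ^ m"
  using assms
proof (induction U arbitrary: m rule: finite_induct)
  case empty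
  have *: "{E. E \<subseteq> {} \<and> card E = m} = (if m = 0 then {{}} else {})"
    by auto
  show ?case unfolding * by (cases "m = 0") simp_all
next
  case (insert a U)
  define s where "s = (\<Sum>e\<in>U. w e)"
  define S where "S = (\<lambda>m. \<Sum>E\<in>{E. E \<subseteq> U \<and> card E = m}. \<Prod>e\<in>E. w e)"
  have s0: "0 \<le> s" and a0: "0 \<le> w a"
    using insert.prems by (auto simp: s_def intro: sum_nonneg)
  have IH: "fact m * S m \<le> s ^ m" for m
    unfolding S_def s_def using insert by auto
  show ?case
  proof (cases m)
    case 0
    have "{E. E \<subseteq> insert a U \<and> card E = 0} = {{}}"
      using insert.hyps finite_subset[of _ "insert a U"] by auto
    then show ?thesis using 0 by simp
  next
    case (Suc k)
    have fin: "finite E" if "E \<subseteq> U" for E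
      using that insert.hyps finite_subset by blast
    have "{E. E \<subseteq> insert a U \<and> card E = Suc k} =
        {E. E \<subseteq> U \<and> card E = Suc k} \<union> insert a ` {E. E \<subseteq> U \<and> card E = k}" (is "?L = ?A \<union> ?B")
    proof (intro equalityI subsetI)
      fix E assume E: "E \<in> ?L"
      show "E \<in> ?A \<union> ?B"
      proof (cases "a \<in> E")
        case True
        have "E - {a} \<subseteq> U" using E by auto
        moreover from this have "card (E - {a}) = k"
          using E True fin[of "E - {a}"] by (simp add: card_Diff_singleton)
        moreover have "E = insert a (E - {a})" using True by auto
        ultimately show ?thesis by blast
      qed (use E in auto)
    next
      fix E assume E: "E \<in> ?A \<union> ?B"
      then show "E \<in> ?L"
      proof
        assume "E \<in> ?B"
        then obtain F where F: "E = insert a F" "F \<subseteq> U" "card F = k" by blast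
        then have "card E = Suc k"
          using fin[OF F(2)] insert.hyps by (subst F) (auto simp: card_insert_if)
        then show ?thesis using F by auto
      qed auto
    qed
    moreover have "?A \<inter> ?B = {}"
      using insert.hyps by auto
    moreover have "finite ?A" "finite ?B"
      using insert.hyps by auto
    ultimately have "(\<Sum>E\<in>?L. \<Prod>e\<in>E. w e) = S (Suc k) + (\<Sum>E\<in>?B. \<Prod>e\<in>E. w e)"
      by (simp add: sum.union_disjoint S_def)
    also have "(\<Sum>E\<in>?B. \<Prod>e\<in>E. w e) = (\<Sum>E\<in>{E. E \<subseteq> U \<and> card E = k}. \<Prod>e\<in>insert a E. w e)"
      by (rule sum.reindex_cong[of "insert a"]) (use insert.hyps in \<open>auto simp: inj_on_def\<close>)
    also have "\<dots> = (\<Sum>E\<in>{E. E \<subseteq> U \<and> card E = k}. w a * (\<Prod>e\<in>E. w e))"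
    proof (rule sum.cong[OF refl])
      fix E assume "E \<in> {E. E \<subseteq> U \<and> card E = k}"
      then have "finite E" "a \<notin> E"
        using fin insert.hyps by auto
      then show "(\<Prod>e\<in>insert a E. w e) = w a * (\<Prod>e\<in>E. w e)" by simp
    qed
    also have "\<dots> = w a * S k"
      by (simp add: S_def sum_distrib_left)
    finally have "fact (Suc k) * (\<Sum>E\<in>?L. \<Prod>e\<in>E. w e) = fact (Suc k) * S (Suc k) + real (Suc k) * w a * (fact k * S k)"
      by (simp add: algebra_simps)
    also have "\<dots> \<le> s ^ Suc k + real (Suc k) * w a * s ^ k"
      using a0 by (intro add_mono mult_left_mono IH) auto
    also have "\<dots> \<le> (w a + s) ^ Suc k"
    proof -
      \<comment> \<open>Only the first two terms of the binomial expansion are needed: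
        \<open>a\<close> is either absent or used once.\<close>
      have "s ^ n + real n * w a * s ^ (n - 1) \<le> (w a + s) ^ n" for n
      proof (induction n)
        case (Suc n)
        have "s ^ Suc n + real (Suc n) * w a * s ^ n \<le> (w a + s) * (s ^ n + real n * w a * s ^ (n - 1))"
        proof (cases n)
          case (Suc j)
          have "0 \<le> real n * w a * w a * s ^ j"
            using a0 s0 by simp
          then show ?thesis
            using Suc by (simp add: algebra_simps)
        qed (simp add: algebra_simps)
        also have "\<dots> \<le> (w a + s) * (w a + s) ^ n"
          using Suc a0 s0 by (intro mult_left_mono) auto
        finally show ?case by simp
      qed simp
      from this[of "Suc k"] show ?thesis by simp
    qed
    finally show ?thesis
      using insert.hyps by (simp add: Suc s_def)
  qed
qed

text \<open>The right side is the falling factorial of \<open>N\<close>, with \<open>m\<close>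
  factors that are all at least \<open>N - m\<close>.\<close>

lemma power_le_fact_binomial:
  assumes "m \<le> N"
  shows "(real N - real m) ^ m \<le> fact m * real (N choose m)"
proof -
  have "(real N - real m) ^ m = (\<Prod>i<m. real N - real m)"
    by simp
  also have "\<dots> \<le> (\<Prod>i<m. real N - real i)"
    using assms by (intro prod_mono) auto
  also have "\<dots> = real (N choose m) * (\<Prod>i<m. real m - real i)"
    using binomial_absorption_prod[of m m N] assms by simp
  also have "(\<Prod>i<m. real m - real i) = fact m"
  proof -
    have "(fact m :: real) = of_nat (\<Prod>i = 0..<m. m - i)"
      by (rule fact_prod_rev)
    also have "\<dots> = (\<Prod>i<m. real m - real i)"
      by (simp add: lessThan_atLeast0 of_nat_diff)
    finally show ?thesis ..
  qed
  finally show ?thesis by (simp add: mult.commute)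
qed

lemma max_cut_attained:
  obtains A where "A \<subseteq> {..<n}" "card (cut_edges A ({..<n} - A) E) = max_cut n E"
proof -
  have "max_cut n E \<in> (\<lambda>A. card (cut_edges A ({..<n} - A) E)) ` Pow {..<n}"
    unfolding max_cut_def by (intro Max_in) auto
  then show ?thesis using that by auto
qed

lemma max_cut_ge: "A \<subseteq> {..<n} \<Longrightarrow> card (cut_edges A ({..<n} - A) E) \<le> max_cut n E"
  unfolding max_cut_def by (intro Max_ge) auto

lemma max_cut_le:
  assumes "E \<in> graphs n m"
  shows "max_cut n E \<le> m"
proof -
  obtain A where "card (cut_edges A ({..<n} - A) E) = max_cut n E"
    using max_cut_attained by metis
  moreover have "finite E" "card E = m"
    using assms finite_subset unfolding graphs_eq by blast+
  ultimately show ?thesis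
    using card_mono[OF _ cut_edges_subset] by metis
qed

lemma card_cut_all_edges:
  assumes "A \<subseteq> {..<n}"
  shows "real (card (cut_edges A ({..<n} - A) (edges_on {..<n}))) \<le> real n ^ 2 / 4"
proof -
  have fin: "finite A"
    using assms finite_subset by blast
  have "cut_edges A ({..<n} - A) (edges_on {..<n}) \<subseteq> (\<lambda>(u, v). {u, v}) ` (A \<times> ({..<n} - A))"
    by (auto simp: cut_edges_def)
  then have "card (cut_edges A ({..<n} - A) (edges_on {..<n})) \<le> card (A \<times> ({..<n} - A))"
    using fin by (meson card_image_le card_mono finite_Diff finite_SigmaI finite_imageI finite_lessThan le_trans)
  also have "\<dots> = card A * (n - card A)"
    using fin assms by (simp add: card_cartesian_product card_Diff_subset)
  finally have "real (card (cut_edges A ({..<n} - A) (edges_on {..<n}))) \<le> real (card A * (n - card A))"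
    by (rule of_nat_mono)
  also have "\<dots> = real (card A) * (real n - real (card A))"
    using card_mono[OF _ assms] by (simp add: of_nat_diff)
  also have "\<dots> \<le> real n ^ 2 / 4"
  proof -
    have "0 \<le> (real n - 2 * real (card A)) ^ 2" by simp
    then show ?thesis by (simp add: power2_eq_square algebra_simps)
  qed
  finally show ?thesis .
qed

text \<open>A graph with \<open>k\<close> components has at least \<open>2\<^sup>k\<close> maximum cuts, so the left side is bounded
  by a sum over all cuts, for which each edge contributes an independent weight.\<close>

lemma mean_weighted_cuts:
  assumes m: "m < n choose 2" and \<mu>: "0 < \<mu>" "\<mu> \<le> 1"
  shows "mean n m (\<lambda>E. 2 ^ card (comps {..<n} E) * \<mu> ^ (m - max_cut n E)) \<le>
    2 ^ n * ((1 + \<mu>) * real n ^ 2 / 4 / (real (n choose 2) - real m)) ^ m"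
proof -
  define cut where "cut = (\<lambda>A E. cut_edges A ({..<n} - A) E)"
  define N where "N = n choose 2"
  define s where "s = (1 + \<mu>) * real n ^ 2 / 4"
  have 1: "2 ^ card (comps {..<n} E) * \<mu> ^ (m - max_cut n E) \<le> (\<Sum>A\<in>Pow {..<n}. \<mu> ^ (m - card (cut A E)))"
    if E: "E \<in> graphs n m" for E
  proof -
    obtain A where A: "A \<subseteq> {..<n}" "card (cut A E) = max_cut n E"
      using max_cut_attained unfolding cut_def by metis
    define \<B> where "\<B> = {B. B \<subseteq> {..<n} \<and> cut B E = cut A E}"
    have "2 ^ card (comps {..<n} E) \<le> card \<B>"
      unfolding \<B>_def cut_def using E A by (intro card_equal_cuts) (auto simp: graphs_eq)
    then have "real (2 ^ card (comps {..<n} E)) \<le> real (card \<B>)"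
      by (rule of_nat_mono)
    then have "2 ^ card (comps {..<n} E) * \<mu> ^ (m - max_cut n E) \<le> real (card \<B>) * \<mu> ^ (m - max_cut n E)"
      using \<mu> by (intro mult_right_mono) auto
    also have "\<dots> = (\<Sum>B\<in>\<B>. \<mu> ^ (m - card (cut B E)))"
      using A by (simp add: \<B>_def)
    also have "\<dots> \<le> (\<Sum>A\<in>Pow {..<n}. \<mu> ^ (m - card (cut A E)))"
      using \<mu> by (intro sum_mono2) (auto simp: \<B>_def)
    finally show ?thesis .
  qed
  have 2: "fact m * (\<Sum>E\<in>graphs n m. \<mu> ^ (m - card (cut A E))) \<le> s ^ m" if A: "A \<subseteq> {..<n}" for A
  proof -
    define U where "U = edges_on {..<n}"
    \<comment> \<open>Crossing edges weigh 1 and the others \<mu>, so the weight of a graph is \<mu>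
      to the number of its uncut edges.\<close>
    define w where "w = (\<lambda>e. if e \<in> cut A U then 1 else \<mu>)"
    have finU: "finite U" by (simp add: U_def)
    have cutU: "cut A U \<subseteq> U"
      unfolding cut_def by (rule cut_edges_subset)
    then have finC: "finite (cut A U)"
      using finU by (rule finite_subset)
    have "\<mu> ^ (m - card (cut A E)) = (\<Prod>e\<in>E. w e)" if E: "E \<in> graphs n m" for E
    proof -
      have EU: "E \<subseteq> U" "card E = m" "finite E"
        using E finU finite_subset by (auto simp: graphs_eq U_def)
      have cE: "cut A E = E \<inter> cut A U"
        using EU(1) by (auto simp: cut_def cut_edges_def)
      have "(\<Prod>e\<in>E. w e) = (\<Prod>e\<in>E \<inter> cut A U. 1) * (\<Prod>e\<in>E \<inter> - cut A U. \<mu>)"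
        unfolding w_def using EU(3) by (simp add: prod.If_cases)
      also have "\<dots> = \<mu> ^ card (E - cut A U)"
        by (simp add: Diff_eq)
      also have "card (E - cut A U) = m - card (cut A E)"
        unfolding cE using EU card_Diff_subset_Int[of E "cut A U"] by simp
      finally show ?thesis ..
    qed
    then have "(\<Sum>E\<in>graphs n m. \<mu> ^ (m - card (cut A E))) = (\<Sum>E\<in>{E. E \<subseteq> U \<and> card E = m}. \<Prod>e\<in>E. w e)"
      unfolding graphs_eq U_def[symmetric] by (rule sum.cong[OF refl])
    then have "fact m * (\<Sum>E\<in>graphs n m. \<mu> ^ (m - card (cut A E))) \<le> (\<Sum>e\<in>U. w e) ^ m"
      using sum_prod_subsets_le[OF finU, of w m] \<mu> by (simp add: w_def)
    also have "\<dots> \<le> s ^ m"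
    proof (rule power_mono)
      have "(\<Sum>e\<in>U. w e) = real (card (U \<inter> cut A U)) + \<mu> * real (card (U \<inter> - cut A U))"
        unfolding w_def using finU by (simp add: sum.If_cases)
      also have "U \<inter> cut A U = cut A U"
        using cutU by blast
      also have "real (card (U \<inter> - cut A U)) = real (card U) - real (card (cut A U))"
        using cutU finC finU card_mono[OF finU cutU] by (simp add: Diff_eq[symmetric] card_Diff_subset of_nat_diff)
      also have "real (card (cut A U)) + \<mu> * (real (card U) - real (card (cut A U))) =
          \<mu> * real (card U) + (1 - \<mu>) * real (card (cut A U))"
        by (simp add: algebra_simps)
      \<comment> \<open>As \<open>1 - \<mu> \<ge> 0\<close>, the total weight is largest for a
        balanced cut, where about half of all pairs cross.\<close>
      also have "\<dots> \<le> \<mu> * (real n ^ 2 / 2) + (1 - \<mu>) * (real n ^ 2 / 4)"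
      proof (intro add_mono mult_left_mono)
        show "real (card U) \<le> real n ^ 2 / 2"
          by (simp add: U_def card_edges_on real_choose_2 power2_eq_square algebra_simps)
        show "real (card (cut A U)) \<le> real n ^ 2 / 4"
          unfolding cut_def U_def using A by (rule card_cut_all_edges)
      qed (use \<mu> in auto)
      also have "\<dots> = s"
        by (simp add: s_def field_simps)
      finally show "(\<Sum>e\<in>U. w e) \<le> s" .
      show "0 \<le> (\<Sum>e\<in>U. w e)"
        using \<mu> by (intro sum_nonneg) (auto simp: w_def)
    qed
    finally show ?thesis .
  qed
  have s0: "0 \<le> s" using \<mu> by (simp add: s_def)
  have Nm: "0 < real N - real m" using m by (simp add: N_def)
  have C: "0 < real (N choose m)" using m by (simp add: N_def)
  have "(\<Sum>E\<in>graphs n m. 2 ^ card (comps {..<n} E) * \<mu> ^ (m - max_cut n E)) \<le>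
      (\<Sum>E\<in>graphs n m. \<Sum>A\<in>Pow {..<n}. \<mu> ^ (m - card (cut A E)))"
    by (rule sum_mono[OF 1])
  also have "\<dots> = (\<Sum>A\<in>Pow {..<n}. \<Sum>E\<in>graphs n m. \<mu> ^ (m - card (cut A E)))"
    by (rule sum.swap)
  also have "\<dots> \<le> (\<Sum>A\<in>Pow {..<n}. s ^ m / fact m)"
    using 2 by (intro sum_mono) (simp add: field_simps)
  also have "\<dots> = 2 ^ n * (s ^ m / fact m)"
    by (simp add: card_Pow)
  finally have "mean n m (\<lambda>E. 2 ^ card (comps {..<n} E) * \<mu> ^ (m - max_cut n E)) \<le>
      2 ^ n * (s ^ m / fact m) / real (N choose m)"
    unfolding mean_def N_def by (rule divide_right_mono) simp
  also have "\<dots> = 2 ^ n * (s ^ m / (fact m * real (N choose m)))"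
    by simp
  also have "\<dots> \<le> 2 ^ n * (s ^ m / (real N - real m) ^ m)"
    using power_le_fact_binomial[of m N] m s0 Nm C
    by (intro mult_left_mono divide_left_mono) (auto simp: N_def)
  also have "\<dots> = 2 ^ n * (s / (real N - real m)) ^ m"
    by (simp add: power_divide)
  finally show ?thesis
    by (simp add: s_def N_def)
qed

section \<open>From the component count to bounds on the mean maximum cut\<close>

text \<open>Jensen's inequality by the tangent \<open>1 + z \<le> exp z\<close> at
  \<open>z = Z - ln M\<close>, which works directly with an upper bound \<open>M\<close> in place of
  the mean itself.\<close>

lemma mean_le_ln_mean_exp:
  assumes m: "m \<le> n choose 2" and M: "mean n m (\<lambda>E. exp (Z E)) \<le> M" "0 < M"
  shows "mean n m Z \<le> ln M"
proof -
  have "mean n m (\<lambda>E. Z E + (1 - ln M)) \<le> mean n m (\<lambda>E. 1 / M * exp (Z E))"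
  proof (rule mean_mono)
    fix E
    have "Z E - ln M + 1 \<le> exp (Z E - ln M)"
      using exp_ge_add_one_self[of "Z E - ln M"] by linarith
    then show "Z E + (1 - ln M) \<le> 1 / M * exp (Z E)"
      using M by (simp add: exp_diff)
  qed
  then have "mean n m Z + (1 - ln M) \<le> 1 / M * mean n m (\<lambda>E. exp (Z E))"
    by (simp only: mean_add mean_cmult mean_const[OF m])
  also have "\<dots> \<le> 1"
    using M by (simp add: field_simps)
  finally show ?thesis by simp
qed

text \<open>The logarithm of the weighted count. The cyclomatic number enters with factor
  \<open>ln 2\<close>, one bit for each component beyond \<open>n - m\<close>, and every uncut edge
  costs \<open>ln (1 / \<mu>)\<close>.\<close>

lemma f_cut_le_comps:
  assumes m: "m < n choose 2" and n: "0 < n" and \<mu>: "0 < \<mu>" "\<mu> < 1"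
  shows "ln (1 / \<mu>) * f_cut n m \<le> ln (1 / \<mu>) * real m - ln 2 * (mean n m (n_comps n) - real n + real m)
    + real m * (\<mu> + (real n / 2 + real m) / (real (n choose 2) - real m))"
proof -
  define N where "N = n choose 2"
  \<comment> \<open>Chosen so that \<open>1 + t\<close> is the ratio of \<open>n\<^sup>2 / 2\<close>
    to \<open>N - m\<close>; for \<open>m\<close> linear in \<open>n\<close> it is of order
    \<open>1 / n\<close>.\<close>
  define t where "t = (real n / 2 + real m) / (real N - real m)"
  \<comment> \<open>Written with sums and scalar factors only, so that \<open>mean_add\<close>,
    \<open>mean_cmult\<close> and \<open>mean_const\<close> evaluate its mean.\<close>
  define Z where "Z = (\<lambda>E. ln 2 * n_comps n E + (- ln (1 / \<mu>)) * (real m + (- 1) * real (max_cut n E)))"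
  define M where "M = 2 ^ n * ((1 + \<mu>) * real n ^ 2 / 4 / (real N - real m)) ^ m"
  have mN: "m \<le> n choose 2" using m by simp
  have Nm: "0 < real N - real m" using m by (simp add: N_def)
  have exZ: "exp (Z E) = 2 ^ card (comps {..<n} E) * \<mu> ^ (m - max_cut n E)" if E: "E \<in> graphs n m" for E
  proof -
    have "Z E = real (card (comps {..<n} E)) * ln 2 + real (m - max_cut n E) * ln \<mu>"
      using max_cut_le[OF E] \<mu> by (simp add: Z_def ln_div of_nat_diff algebra_simps)
    then show ?thesis
      using \<mu> by (simp add: exp_add exp_of_nat_mult)
  qed
  have "mean n m (\<lambda>E. exp (Z E)) \<le> mean n m (\<lambda>E. 2 ^ card (comps {..<n} E) * \<mu> ^ (m - max_cut n E))"
    by (rule mean_mono) (simp add: exZ)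
  also have "\<dots> \<le> M"
    unfolding M_def N_def using m \<mu> by (intro mean_weighted_cuts) auto
  finally have le: "mean n m (\<lambda>E. exp (Z E)) \<le> M" .
  have M0: "0 < M"
    unfolding M_def using \<mu> n Nm by (intro mult_pos_pos zero_less_power divide_pos_pos) auto
  have "mean n m Z \<le> ln M"
    by (rule mean_le_ln_mean_exp[OF mN le M0])
  moreover have "mean n m Z = ln 2 * mean n m (n_comps n) - ln (1 / \<mu>) * (real m - f_cut n m)"
    unfolding Z_def mean_add mean_cmult mean_const[OF mN] f_cut_eq_mean[OF mN] by simp
  moreover have "ln M \<le> ln 2 * (real n - real m) + real m * (\<mu> + t)"
  proof -
    have eq: "(1 + \<mu>) * real n ^ 2 / 4 / (real N - real m) = (1 + \<mu>) * (1 + t) / 2"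
    proof -
      have "1 + t = (real n ^ 2 / 2) / (real N - real m)"
        unfolding t_def using Nm by (simp add: N_def real_choose_2 power2_eq_square field_simps)
      then show ?thesis by simp
    qed
    have t0: "0 \<le> t"
      unfolding t_def using Nm by simp
    have "ln M = real n * ln 2 + real m * (ln (1 + \<mu>) + ln (1 + t) - ln 2)"
      unfolding M_def eq using \<mu> t0 by (simp add: ln_mult ln_div ln_realpow)
    also have "\<dots> \<le> real n * ln 2 + real m * (\<mu> + t - ln 2)"
      using \<mu> t0 ln_add_one_self_le_self[of \<mu>] ln_add_one_self_le_self[of t]
      by (intro add_left_mono mult_left_mono) auto
    finally show ?thesis by (simp add: algebra_simps)
  qed
  ultimately have "ln 2 * mean n m (n_comps n) - ln (1 / \<mu>) * (real m - f_cut n m) \<le>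
      ln 2 * (real n - real m) + real m * (\<mu> + t)"
    by simp
  then show ?thesis
    by (simp add: t_def N_def algebra_simps)
qed

lemma f_cut_ge_comps:
  assumes "m \<le> n choose 2"
  shows "real n - mean n m (n_comps n) \<le> f_cut n m"
proof -
  have "real n = mean n m (\<lambda>E. real n)"
    using assms by (simp add: mean_const)
  also have "\<dots> \<le> mean n m (\<lambda>E. real (max_cut n E) + n_comps n E)"
  proof (rule mean_mono)
    fix E assume "E \<in> graphs n m"
    then obtain A where "A \<subseteq> {..<n}"
        "card {..<n} \<le> card (cut_edges A ({..<n} - A) E) + card (comps {..<n} E)"
      using large_cut[of "{..<n}" E] by (auto simp: graphs_eq)
    then show "real n \<le> real (max_cut n E) + n_comps n E"
      using max_cut_ge[of A n E] by simp
  qed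
  finally show ?thesis
    using assms by (simp add: mean_add f_cut_eq_mean)
qed

lemma f_cut_le: "m \<le> n choose 2 \<Longrightarrow> f_cut n m \<le> real m"
  using mean_mono[of n m "\<lambda>E. real (max_cut n E)" "\<lambda>_. real m"] max_cut_le
  by (simp add: f_cut_eq_mean mean_const)

lemma f_cut_nonneg: "m \<le> n choose 2 \<Longrightarrow> 0 \<le> f_cut n m"
  by (simp add: f_cut_eq_mean mean_def sum_nonneg)

section \<open>Asymptotic comparison\<close>

text \<open>Only real bounds \<open>y\<close> matter: a bound above 1 in the extended reals is real
  or infinite, and the infinite case is trivial.\<close>

lemma asymp_leI:
  assumes "\<And>y::real. 1 < y \<Longrightarrow> \<forall>\<^sub>F n in sequentially. a n / b n < y"
  shows "asymp_le a b"
  unfolding asymp_le_def Limsup_le_iff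
proof (intro allI impI)
  fix y :: ereal assume y: "1 < y"
  show "\<forall>\<^sub>F n in sequentially. ereal (a n / b n) < y"
  proof (cases y)
    case (real r)
    then have "1 < r" using y by simp
    from assms[OF this] show ?thesis by (simp add: real)
  qed (use y in auto)
qed

lemma asymp_le_linear_left:
  assumes nonneg: "\<forall>\<^sub>F n in sequentially. 0 \<le> b n"
    and le: "\<And>\<eta>. 0 < \<eta> \<Longrightarrow> \<forall>\<^sub>F n in sequentially. (A - \<eta>) * real n \<le> b n"
  shows "asymp_le (\<lambda>n. A * real n) b"
proof (rule asymp_leI)
  fix y :: real assume y: "1 < y"
  show "\<forall>\<^sub>F n in sequentially. A * real n / b n < y"
  proof (cases "A \<le> 0")
    \<comment> \<open>For large \<epsilon> the coefficient
      \<open>1/2 + \<epsilon> - 16/3 \<epsilon>^3\<close> is negative; the ratio is then at most 0,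
      also where \<open>b n = 0\<close>.\<close>
    case True
    show ?thesis
      using nonneg
    proof eventually_elim
      case (elim n)
      have "A * real n / b n \<le> 0"
        using True elim by (intro divide_nonpos_nonneg mult_nonpos_nonneg) auto
      then show ?case using y by simp
    qed
  next
    case False
    \<comment> \<open>\<open>A - \<eta>\<close> is the midpoint of \<open>A / y\<close> and
      \<open>A\<close>.\<close>
    define \<eta> where "\<eta> = A * (1 - 1 / y) / 2"
    have \<eta>: "0 < \<eta>"
      using False y by (simp add: \<eta>_def)
    have *: "A < y * (A - \<eta>)"
    proof -
      have "y * (A - \<eta>) - A = A * (y - 1) / 2"
        using y by (simp add: \<eta>_def field_simps)
      moreover have "0 < A * (y - 1) / 2"
        using False y by simp
      ultimately show ?thesis by linarith
    qed
    have A\<eta>: "0 < A - \<eta>"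
    proof (rule ccontr)
      assume "\<not> 0 < A - \<eta>"
      then have "y * (A - \<eta>) \<le> 0"
        using y by (intro mult_nonneg_nonpos) auto
      then show False using * False by linarith
    qed
    show ?thesis
      using le[OF \<eta>] eventually_gt_at_top[of 0]
    proof eventually_elim
      case (elim n)
      have "0 < (A - \<eta>) * real n"
        using A\<eta> elim by simp
      then have b: "0 < b n"
        using elim by linarith
      have "A * real n < y * (A - \<eta>) * real n"
        using * elim by simp
      also have "\<dots> \<le> y * b n"
        using y elim by (simp add: mult.assoc)
      finally show ?case
        using b by (simp add: pos_divide_less_eq)
    qed
  qed
qed

lemma asymp_le_linear_right:
  assumes B: "0 < B" and le: "\<And>\<eta>. 0 < \<eta> \<Longrightarrow> \<forall>\<^sub>F n in sequentially. a n \<le> (B + \<eta>) * real n"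
  shows "asymp_le a (\<lambda>n. B * real n)"
proof (rule asymp_leI)
  fix y :: real assume y: "1 < y"
  \<comment> \<open>\<open>B + \<eta>\<close> is the midpoint of \<open>B\<close> and
    \<open>y * B\<close>.\<close>
  define \<eta> where "\<eta> = B * (y - 1) / 2"
  have \<eta>: "0 < \<eta>" "B + \<eta> < y * B"
  proof -
    have "y * B - (B + \<eta>) = B * (y - 1) / 2"
      by (simp add: \<eta>_def field_simps)
    moreover have "0 < B * (y - 1) / 2"
      using B y by simp
    ultimately show "0 < \<eta>" "B + \<eta> < y * B" by (auto simp: \<eta>_def)
  qed
  show "\<forall>\<^sub>F n in sequentially. a n / (B * real n) < y"
    using le[OF \<eta>(1)] eventually_gt_at_top[of 0]
  proof eventually_elim
    case (elim n)
    have "a n < y * B * real n"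
      using elim \<eta>(2) by (intro le_less_trans[OF elim(1)]) simp
    then show ?case
      using B elim by (simp add: pos_divide_less_eq mult_ac)
  qed
qed

text \<open>This is \<open>\<mu> / ln (1 / \<mu>)\<close> for
  \<open>\<mu> = \<epsilon>^3 / 48\<close>. The gain \<open>ln 2 * \<epsilon>^3 / 12\<close> is at
  least \<open>2 \<mu>\<close> because \<open>ln 2 \<ge> 1/2\<close>, and the loss
  \<open>\<mu> m\<close> consumes at most one \<mu> per vertex because \<open>m \<le> n\<close> for
  \<epsilon> \<le> 1/2. Larger \<epsilon> get the trivial bound by the number of edges.\<close>

definition deficit :: "real \<Rightarrow> real" where
  "deficit \<epsilon> = (if 0 < \<epsilon> \<and> \<epsilon> \<le> 1 / 2 then \<epsilon> ^ 3 / 48 / ln (48 / \<epsilon> ^ 3) else 0)"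

text \<open>The logarithm that divides the gain is at least 1, so it never enlarges the error
  terms.\<close>

lemma ln_48:
  fixes \<epsilon> :: real
  assumes \<epsilon>: "0 < \<epsilon>" "\<epsilon> \<le> 1 / 2"
  shows "1 \<le> ln (48 / \<epsilon> ^ 3)"
proof -
  have "\<epsilon> ^ 3 \<le> 1"
    using \<epsilon> by (intro power_le_one) auto
  then have "3 \<le> 48 / \<epsilon> ^ 3"
    using \<epsilon> by (simp add: field_simps)
  then have "exp 1 \<le> 48 / \<epsilon> ^ 3"
    using exp_le by linarith
  then show ?thesis
    using \<epsilon> by (subst ln_ge_iff) auto
qed

lemma deficit_nonneg: "0 \<le> deficit \<epsilon>"
  using ln_48[of \<epsilon>] power_le_one[of \<epsilon> 3] by (auto simp: deficit_def intro!: divide_nonneg_nonneg)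

lemma deficit_less: "0 < \<epsilon> \<Longrightarrow> deficit \<epsilon> < 1 / 2 + \<epsilon>"
proof -
  assume \<epsilon>: "0 < \<epsilon>"
  show ?thesis
  proof (cases "\<epsilon> \<le> 1 / 2")
    case True
    have "\<epsilon> ^ 3 \<le> 1"
      using \<epsilon> True by (intro power_le_one) auto
    moreover from this have "\<epsilon> ^ 3 / 48 / ln (48 / \<epsilon> ^ 3) \<le> \<epsilon> ^ 3 / 48 / 1"
      using ln_48[OF \<epsilon> True] \<epsilon> \<open>\<epsilon> ^ 3 \<le> 1\<close> by (intro divide_left_mono mult_pos_pos) auto
    ultimately show ?thesis
      using \<epsilon> True by (simp add: deficit_def)
  qed (use \<epsilon> in \<open>simp add: deficit_def\<close>)
qed

lemma deficit_bigomega: "deficit \<in> \<Omega>[at_right 0](\<lambda>\<epsilon>. \<epsilon> ^ 3 / ln (1 / \<epsilon>))"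
proof (rule landau_omega.bigI[of "1 / 192"])
  have "\<forall>\<^sub>F \<epsilon>::real in at_right 0. \<epsilon> \<in> {0<..<1 / 48}"
    by (rule eventually_at_right_real) simp
  then show "\<forall>\<^sub>F \<epsilon> in at_right 0. 1 / 192 * norm (\<epsilon> ^ 3 / ln (1 / \<epsilon>)) \<le> norm (deficit \<epsilon>)"
  proof eventually_elim
    case (elim \<epsilon>)
    then have \<epsilon>: "0 < \<epsilon>" "\<epsilon> < 1 / 48" by auto
    \<comment> \<open>Below \<open>1 / 48\<close> the constant is absorbed:
      \<open>ln (48 / \<epsilon>^3) \<le> 4 ln (1 / \<epsilon>)\<close>, hence the factor
      \<open>1 / 192\<close> with \<open>192 = 4 * 48\<close>.\<close>
    have "ln 48 \<le> ln (1 / \<epsilon>)"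
      using \<epsilon> by (subst ln_le_cancel_iff) (auto simp: field_simps)
    moreover have "ln (48 / \<epsilon> ^ 3) = ln 48 + 3 * ln (1 / \<epsilon>)"
      using \<epsilon> by (simp add: ln_div ln_realpow)
    ultimately have le: "ln (48 / \<epsilon> ^ 3) \<le> 4 * ln (1 / \<epsilon>)"
      by simp
    have pos: "0 < ln (48 / \<epsilon> ^ 3)"
      using ln_48[of \<epsilon>] \<epsilon> by linarith
    have "1 / 192 * (\<epsilon> ^ 3 / ln (1 / \<epsilon>)) = \<epsilon> ^ 3 / 48 / (4 * ln (1 / \<epsilon>))"
      by simp
    also have "\<dots> \<le> \<epsilon> ^ 3 / 48 / ln (48 / \<epsilon> ^ 3)"
      using le pos \<epsilon> by (intro divide_left_mono mult_pos_pos) auto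
    also have "\<dots> = deficit \<epsilon>"
      using \<epsilon> by (simp add: deficit_def)
    finally show ?case
      using \<epsilon> deficit_nonneg[of \<epsilon>] by simp
  qed
qed simp

text \<open>The hidden constant becomes one function \<open>g\<close>, fixed before \<epsilon>. Its
  bounds keep \<open>1/2 + \<epsilon> - g \<epsilon>\<close> positive, as a meaningful upper
  comparison requires.\<close>

theorem theorem21:
  "\<exists>g :: real \<Rightarrow> real.
     g \<in> \<Omega>[at_right 0](\<lambda>\<epsilon>. \<epsilon> ^ 3 / ln (1 / \<epsilon>)) \<and>
     (\<forall>\<epsilon>>0. 0 \<le> g \<epsilon> \<and> g \<epsilon> < 1/2 + \<epsilon> \<and>
        asymp_le (\<lambda>n. (1/2 + \<epsilon> - 16/3 * \<epsilon> ^ 3) * real n)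
                 (\<lambda>n. f_cut n (nat \<lfloor>(1/2 + \<epsilon>) * real n\<rfloor>)) \<and>
        asymp_le (\<lambda>n. f_cut n (nat \<lfloor>(1/2 + \<epsilon>) * real n\<rfloor>))
                 (\<lambda>n. (1/2 + \<epsilon> - g \<epsilon>) * real n))"
proof (intro exI[of _ deficit] conjI allI impI)
  fix \<epsilon> :: real assume \<epsilon>: "0 < \<epsilon>"
  define m where "m = (\<lambda>n::nat. nat \<lfloor>(1/2 + \<epsilon>) * real n\<rfloor>)"
  have m: "(\<lambda>n. real (m n) / real n) \<longlonglongrightarrow> 1 / 2 + \<epsilon>"
    unfolding m_def using \<epsilon> by (intro floor_linear) simp
  have m_le: "real (m n) \<le> (1 / 2 + \<epsilon>) * real n" for n
    unfolding m_def using \<epsilon> by (intro of_nat_floor) simp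
  have mN: "\<forall>\<^sub>F n in sequentially. m n \<le> n choose 2"
    by (rule eventually_le_choose_2[OF m])
  obtain x where x: "x \<le> 16 / 3 * \<epsilon> ^ 3" "\<epsilon> \<le> 1 / 2 \<Longrightarrow> \<epsilon> ^ 3 / 12 \<le> x"
    and upper: "\<And>\<eta>. 0 < \<eta> \<Longrightarrow> \<forall>\<^sub>F n in sequentially. mean n (m n) (n_comps n) \<le> (1 / 2 - \<epsilon> + x + \<eta>) * real n"
    and lower: "\<And>\<eta>. 0 < \<eta> \<Longrightarrow> \<forall>\<^sub>F n in sequentially. (1 / 2 - \<epsilon> + x - \<eta>) * real n \<le> mean n (m n) (n_comps n)"
    using mean_comps_supercritical[OF \<epsilon> m] by blast
  have "asymp_le (\<lambda>n. (1/2 + \<epsilon> - 16/3 * \<epsilon> ^ 3) * real n) (\<lambda>n. f_cut n (m n))"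
  proof (rule asymp_le_linear_left)
    show "\<forall>\<^sub>F n in sequentially. 0 \<le> f_cut n (m n)"
      using mN by eventually_elim (rule f_cut_nonneg)
    fix \<eta> :: real assume \<eta>: "0 < \<eta>"
    show "\<forall>\<^sub>F n in sequentially. (1/2 + \<epsilon> - 16/3 * \<epsilon> ^ 3 - \<eta>) * real n \<le> f_cut n (m n)"
      using upper[OF \<eta>] mN
    proof eventually_elim
      case (elim n)
      have "(1/2 + \<epsilon> - 16/3 * \<epsilon> ^ 3 - \<eta>) * real n \<le> (1 - (1 / 2 - \<epsilon> + x + \<eta>)) * real n"
        using x(1) by (intro mult_right_mono) auto
      also have "\<dots> = real n - (1 / 2 - \<epsilon> + x + \<eta>) * real n"
        by (simp add: algebra_simps)
      also have "\<dots> \<le> f_cut n (m n)"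
        using elim(1) f_cut_ge_comps[OF elim(2)] by linarith
      finally show ?case .
    qed
  qed
  then show "asymp_le (\<lambda>n. (1/2 + \<epsilon> - 16/3 * \<epsilon> ^ 3) * real n) (\<lambda>n. f_cut n (nat \<lfloor>(1/2 + \<epsilon>) * real n\<rfloor>))"
    unfolding m_def .
  have "asymp_le (\<lambda>n. f_cut n (m n)) (\<lambda>n. (1/2 + \<epsilon> - deficit \<epsilon>) * real n)"
  proof (rule asymp_le_linear_right)
    show "0 < 1/2 + \<epsilon> - deficit \<epsilon>"
      using deficit_less[OF \<epsilon>] by simp
    fix \<eta> :: real assume \<eta>: "0 < \<eta>"
    show "\<forall>\<^sub>F n in sequentially. f_cut n (m n) \<le> (1/2 + \<epsilon> - deficit \<epsilon> + \<eta>) * real n"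
    proof (cases "\<epsilon> \<le> 1 / 2")
      case False
      show ?thesis
        using mN
      proof eventually_elim
        case (elim n)
        have "f_cut n (m n) \<le> (1 / 2 + \<epsilon>) * real n"
          using f_cut_le[OF elim] m_le[of n] by linarith
        also have "\<dots> \<le> (1/2 + \<epsilon> - deficit \<epsilon> + \<eta>) * real n"
          using False \<eta> by (intro mult_right_mono) (auto simp: deficit_def)
        finally show ?case .
      qed
    next
      case True
      define \<mu> where "\<mu> = \<epsilon> ^ 3 / 48"
      define L where "L = ln (1 / \<mu>)"
      have "\<epsilon> ^ 3 \<le> 1"
        using \<epsilon> True by (intro power_le_one) auto
      then have \<mu>: "0 < \<mu>" "\<mu> < 1"
        using \<epsilon> by (auto simp: \<mu>_def)
      have L: "1 \<le> L"
        using ln_48[OF \<epsilon> True] by (simp add: L_def \<mu>_def)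
      have def: "deficit \<epsilon> = \<mu> / L"
        using \<epsilon> True by (simp add: deficit_def L_def \<mu>_def)
      define t where "t = (\<lambda>n. (real n / 2 + real (m n)) / (real (n choose 2) - real (m n)))"
      have t: "t \<longlonglongrightarrow> 0"
      proof -
        have "(\<lambda>n. (1 / 2 + real (m n) / real n) / (real (n choose 2) / real n ^ 2 - real (m n) / real n ^ 2) * (1 / real n))
            \<longlonglongrightarrow> (1 / 2 + (1 / 2 + \<epsilon>)) / (1 / 2 - 0) * 0"
          by (intro tendsto_intros m choose_2_ratio linear_over_square[OF m] lim_1_over_n) simp
        then have "(\<lambda>n. (1 / 2 + real (m n) / real n) / (real (n choose 2) / real n ^ 2 - real (m n) / real n ^ 2) * (1 / real n)) \<longlonglongrightarrow> 0"
          by simp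
        then show ?thesis
        proof (rule Lim_transform_eventually)
          show "\<forall>\<^sub>F n in sequentially. (1 / 2 + real (m n) / real n) /
              (real (n choose 2) / real n ^ 2 - real (m n) / real n ^ 2) * (1 / real n) = t n"
            using eventually_gt_at_top[of 0]
          proof eventually_elim
            case (elim n)
            have "1 / 2 + real (m n) / real n = (real n / 2 + real (m n)) / real n"
              using elim by (simp add: field_simps)
            then show ?case
              using elim by (simp add: t_def diff_divide_distrib[symmetric] power2_eq_square)
          qed
        qed
      qed
      \<comment> \<open>Strictness, required for the denominator \<open>N - m\<close>, comes from
        applying the weak bound to \<open>Suc (m n)\<close>.\<close>
      have mN': "\<forall>\<^sub>F n in sequentially. m n < n choose 2"
      proof -
        have "(\<lambda>n. real (Suc (m n)) / real n) \<longlonglongrightarrow> 1 / 2 + \<epsilon>"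
          using tendsto_add[OF m lim_1_over_n] by (simp add: add_divide_distrib add.commute)
        then have "\<forall>\<^sub>F n in sequentially. Suc (m n) \<le> n choose 2"
          by (rule eventually_le_choose_2)
        then show ?thesis by (simp add: Suc_le_eq)
      qed
      \<comment> \<open>Three errors of this size occur: one in the component count, one in
        \<open>m n / n\<close> and one in \<open>t n\<close>; the first two carry a factor
        \<open>ln 2 \<le> 1\<close>.\<close>
      define \<eta>' where "\<eta>' = \<eta> / 4"
      have \<eta>': "0 < \<eta>'" using \<eta> by (simp add: \<eta>'_def)
      have mlow: "\<forall>\<^sub>F n in sequentially. 1 / 2 + \<epsilon> - \<eta>' < real (m n) / real n"
        using order_tendstoD(1)[OF m] \<eta>' by simp
      have tsmall: "\<forall>\<^sub>F n in sequentially. t n < \<eta>'"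
        using order_tendstoD(2)[OF t \<eta>'] .
      show ?thesis
        using lower[OF \<eta>'] mN' mlow tsmall eventually_gt_at_top[of 0]
      proof eventually_elim
        case (elim n)
        let ?C = "mean n (m n) (n_comps n)"
        have n0: "0 < real n" using elim by simp
        have m1: "real (m n) \<le> real n"
        proof -
          have "(1 / 2 + \<epsilon>) * real n \<le> 1 * real n"
            using True by (intro mult_right_mono) auto
          then show ?thesis using m_le[of n] by simp
        qed
        have mn: "(1 / 2 + \<epsilon> - \<eta>') * real n \<le> real (m n)"
          using elim(3) n0 by (simp add: pos_less_divide_eq)
        have ln2: "1 / 2 \<le> ln (2::real)" "ln (2::real) \<le> 1"
          using ln2_ge_two_thirds ln_le_minus_one[of 2] by auto
        have "(x - 2 * \<eta>') * real n \<le> ?C - real n + real (m n)"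
          using elim(1) mn by (simp add: algebra_simps)
        then have "ln 2 * ((x - 2 * \<eta>') * real n) \<le> ln 2 * (?C - real n + real (m n))"
          using ln2 by (intro mult_left_mono) auto
        moreover have "(2 * \<mu> - 2 * \<eta>') * real n \<le> ln 2 * ((x - 2 * \<eta>') * real n)"
        proof -
          \<comment> \<open>\<open>x \<ge> \<epsilon>^3 / 12 = 4 \<mu>\<close>, and half of it
            survives the factor \<open>ln 2\<close>.\<close>
          have \<mu>x: "2 * \<mu> \<le> 1 / 2 * x"
            using x(2)[OF True] by (simp add: \<mu>_def)
          also have "\<dots> \<le> ln 2 * x"
            by (rule mult_right_mono) (use ln2 \<mu>x \<mu> in linarith)+
          finally have "2 * \<mu> \<le> ln 2 * x" .
          moreover have "ln 2 * (2 * \<eta>') \<le> 1 * (2 * \<eta>')"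
            by (rule mult_right_mono[OF ln2(2)]) (use \<eta>' in simp)
          ultimately have "2 * \<mu> - 2 * \<eta>' \<le> ln 2 * x - ln 2 * (2 * \<eta>')"
            by linarith
          then have "(2 * \<mu> - 2 * \<eta>') * real n \<le> (ln 2 * x - ln 2 * (2 * \<eta>')) * real n"
            by (rule mult_right_mono) simp
          then show ?thesis by (simp add: algebra_simps)
        qed
        moreover have "real (m n) * (\<mu> + t n) \<le> real n * (\<mu> + \<eta>')"
        proof -
          have "real (m n) * (\<mu> + t n) \<le> real (m n) * (\<mu> + \<eta>')"
            using elim(4) by (intro mult_left_mono) auto
          also have "\<dots> \<le> real n * (\<mu> + \<eta>')"
            using m1 \<mu> \<eta>' by (intro mult_right_mono) auto
          finally show ?thesis .
        qed
        moreover have "L * f_cut n (m n) \<le> L * real (m n) - ln 2 * (?C - real n + real (m n)) + real (m n) * (\<mu> + t n)"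
          unfolding L_def t_def using elim \<mu> by (intro f_cut_le_comps) auto
        ultimately have "L * f_cut n (m n) \<le> L * real (m n) - (2 * \<mu> - 2 * \<eta>') * real n + real n * (\<mu> + \<eta>')"
          by linarith
        also have "\<dots> \<le> L * ((1 / 2 + \<epsilon>) * real n) - (2 * \<mu> - 2 * \<eta>') * real n + real n * (\<mu> + \<eta>')"
          using m_le[of n] L by simp
        also have "\<dots> = L * ((1 / 2 + \<epsilon>) * real n) - \<mu> * real n + 3 * \<eta>' * real n"
          by (simp add: algebra_simps)
        \<comment> \<open>The error is given a factor \<open>L \<ge> 1\<close> so that
          \<open>L\<close> cancels from the whole inequality.\<close>
        also have "\<dots> \<le> L * ((1 / 2 + \<epsilon>) * real n) - \<mu> * real n + L * (\<eta> * real n)"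
        proof -
          have "3 * \<eta>' * real n \<le> \<eta> * real n"
            using \<eta> by (simp add: \<eta>'_def)
          also have "\<dots> \<le> L * (\<eta> * real n)"
            using mult_right_mono[OF L, of "\<eta> * real n"] \<eta> by simp
          finally show ?thesis by simp
        qed
        also have "\<dots> = L * ((1/2 + \<epsilon> - deficit \<epsilon> + \<eta>) * real n)"
          unfolding def using L by (simp add: field_simps)
        finally show ?case
          using L by simp
      qed
    qed
  qed
  then show "asymp_le (\<lambda>n. f_cut n (nat \<lfloor>(1/2 + \<epsilon>) * real n\<rfloor>)) (\<lambda>n. (1/2 + \<epsilon> - deficit \<epsilon>) * real n)"
    unfolding m_def .
qed (auto intro: deficit_bigomega deficit_nonneg deficit_less)

end
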